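(* Let $n,N$ be positive integers and let $X_1,\dots,X_N$ be independent isotropic random vectors valued in $\mathbb{R}^n$. Assume that for some $C,\eta>0$ one has, for every $i$, $$\sup_{\|x\|_2\le1}\mathbb{E}|\langle X_i,x\rangle|^{2+\eta}\le C.$$ Let $\varepsilon>0$ and let $$N\ge C_{\mathrm{lower}}\,\varepsilon^{-2-2/\eta}\cdot n,\qquad C_{\mathrm{lower}}=40\,(10C)^{2/\eta}.$$ Then the minimum eigenvalue of the sample covariance matrix $\Sigma_N=\frac1N\sum_{i=1}^NX_iX_i^T$ satisfies $$\mathbb{E}\lambda_{\min}(\Sigma_N)\ge1-\varepsilon.$$
   Context: A random vector $X$ in $\mathbb{R}^n$ is isotropic if $\mathbb{E}XX^T=I$; it need not be centered. $\lambda_{\min}$ denotes the smallest eigenvalue of a symmetric matrix, and $\|\cdot\|_2$ the Euclidean norm. *)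

theory Defs
  imports "HOL-Probability.Probability"
begin

definition outer_square :: "real ^ 'n \<Rightarrow> real ^ 'n ^ 'n" where
  "outer_square x = (\<chi> i j. x $ i * x $ j)"

(* The expectation of the random matrix X X^T is a matrix-valued Bochner integral.
   Integrability is required explicitly, since the integral of a non-integrable
   function is 0 by convention. The mean of X is unconstrained. *)
definition isotropic :: "'a measure \<Rightarrow> ('a \<Rightarrow> real ^ 'n) \<Rightarrow> bool" where
  "isotropic M X \<longleftrightarrow>
     X \<in> borel_measurable M \<and>
     integrable M (\<lambda>\<omega>. outer_square (X \<omega>)) \<and>
     (\<integral>\<omega>. outer_square (X \<omega>) \<partial>M) = mat 1"

definition eigenvalue :: "real ^ 'n ^ 'n \<Rightarrow> real \<Rightarrow> bool" where
  "eigenvalue A \<mu> \<longleftrightarrow> (\<exists>v. v \<noteq> 0 \<and> A *v v = \<mu> *\<^sub>R v)"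

(* Only meaningful for matrices with a real eigenvalue; every symmetric matrix has one. *)
definition lambda_min :: "real ^ 'n ^ 'n \<Rightarrow> real" where
  "lambda_min A = (LEAST \<mu>. eigenvalue A \<mu>)"

definition sample_covariance :: "nat \<Rightarrow> (nat \<Rightarrow> 'a \<Rightarrow> real ^ 'n) \<Rightarrow> 'a \<Rightarrow> real ^ 'n ^ 'n" where
  "sample_covariance N X \<omega> = (1 / real N) *\<^sub>R (\<Sum>i=1..N. outer_square (X i \<omega>))"

end

theory Submission
  imports Defs
begin

text \<open>
  The smallest eigenvalue of \<open>A\<^sub>k = \<Sum>i\<le>k. X\<^sub>i X\<^sub>i\<^sup>T\<close> is bounded below by a random barrier
  \<open>l\<^sub>k\<close>, in the spirit of Batson, Spielman and Srivastava. Starting from \<open>l\<^sub>0 = - n / \<phi>\<close>, the barrier moves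
  so that \<open>A\<^sub>k - l\<^sub>k\<close> stays positive definite and the trace of its inverse stays at most \<open>\<phi>\<close>; the
  rank-one update formula shows that, with \<open>R = (A\<^sub>k - l\<^sub>k)\<^sup>-\<^sup>1\<close> and \<open>x = X\<^sub>k\<^sub>+\<^sub>1\<close>, a shift by
  \<open>(1 - s)\<^sup>2 \<bar>R x\<bar>\<^sup>2 / trace (R\<^sup>2)\<close> is allowed whenever \<open>x \<bullet> R x \<le> s\<close> and
  \<open>\<bar>R x\<bar>\<^sup>2 / trace (R\<^sup>2) \<le> s / \<phi>\<close>. By isotropy the quotient has conditional mean 1, and by convexity the
  moment condition bounds the loss from the two truncations by \<open>2 C (\<phi> / s)\<^bsup>\<eta>/2\<^esup>\<close>. The choice
  \<open>s = \<epsilon> / 10\<close>, \<open>\<phi> = s (\<epsilon> / (10 C))\<^bsup>2/\<eta>\<^esup>\<close> makes the drift at least \<open>1 - 2 \<epsilon> / 5\<close>, while the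
  initial debt \<open>n / \<phi>\<close> is at most \<open>N \<epsilon> / 4\<close>.
\<close>

section \<open>Spectral decomposition of symmetric matrices\<close>

lemma mat_mult_vec: "mat c *v v = c *\<^sub>R (v :: real ^ 'n)"
  by (simp add: vec_eq_iff matrix_vector_mult_def mat_def if_distrib[of "\<lambda>x. x * _"] cong: if_cong)

lemma inner_symmetric_matrix:
  fixes A :: "real ^ 'n ^ 'n"
  assumes "transpose A = A"
  shows "x \<bullet> (A *v y) = (A *v x) \<bullet> y"
  by (metis assms dot_lmul_matrix inner_commute transpose_matrix_vector)

text \<open>First-order optimality: if \<open>B *v e\<close> were nonzero, a small step from
  \<open>e\<close> against it would make the form negative, because the form is 0 at
  \<open>e\<close> and the linear term dominates the quadratic one.\<close>

lemma psd_form_zero: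
  fixes B :: "real ^ 'n ^ 'n"
  assumes B: "transpose B = B" and S: "subspace S" and inv: "\<And>v. v \<in> S \<Longrightarrow> B *v v \<in> S"
    and psd: "\<And>v. v \<in> S \<Longrightarrow> 0 \<le> v \<bullet> (B *v v)"
    and e: "e \<in> S" "e \<bullet> (B *v e) = 0"
  shows "B *v e = 0"
proof (rule ccontr)
  assume nz: "B *v e \<noteq> 0"
  define w where "w = B *v e"
  define q where "q = w \<bullet> (B *v w)"
  have w: "w \<in> S" using inv e by (simp add: w_def)
  have q: "q \<ge> 0" using psd w q_def by simp
  have ww: "w \<bullet> w > 0" using nz w_def by simp
  have *: "0 \<le> - 2 * t * (w \<bullet> w) + t\<^sup>2 * q" for t
  proof -
    have "e - t *\<^sub>R w \<in> S" using S e w by (simp add: subspace_diff subspace_scale)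
    then have "0 \<le> (e - t *\<^sub>R w) \<bullet> (B *v (e - t *\<^sub>R w))" by (rule psd)
    also have "\<dots> = e \<bullet> (B *v e) - t * (e \<bullet> (B *v w)) - t * (w \<bullet> (B *v e)) + t\<^sup>2 * q"
      by (simp add: matrix_vector_mult_diff_distrib matrix_vector_mult_scaleR inner_diff_left
          inner_diff_right q_def power2_eq_square algebra_simps)
    also have "e \<bullet> (B *v w) = w \<bullet> w"
      using inner_symmetric_matrix[OF B, of e w] by (simp add: w_def)
    finally show ?thesis using e by (simp add: w_def)
  qed
  \<comment> \<open>Adding 1 to \<open>q\<close> keeps the denominator positive and still gives
    \<open>t * q \<le> w \<bullet> w\<close>, so the quadratic term takes back at most half of the
    linear gain.\<close>
  define t where "t = (w \<bullet> w) / (q + 1)"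
  have t: "t > 0" using ww q t_def by simp
  have "t * q \<le> w \<bullet> w" using q ww by (simp add: t_def field_simps)
  then have "t * (t * q) \<le> t * (w \<bullet> w)" using t by simp
  then have "- 2 * t * (w \<bullet> w) + t\<^sup>2 * q \<le> - t * (w \<bullet> w)"
    by (simp add: power2_eq_square algebra_simps)
  also have "\<dots> < 0" using t ww by simp
  finally show False using *[of t] by simp
qed

text \<open>Compactness of the unit sphere of \<open>S\<close> gives a minimizer \<open>e\<close>
  with minimum \<open>l\<close>. The form of \<open>A - mat l\<close> is nonnegative on
  \<open>S\<close> and vanishes at \<open>e\<close>, so \<open>psd_form_zero\<close> yields the
  eigenvector equation without Lagrange multipliers.\<close>

lemma rayleigh_minimizer:
  fixes A :: "real ^ 'n ^ 'n"
  assumes A: "transpose A = A" and S: "subspace S" and inv: "\<And>v. v \<in> S \<Longrightarrow> A *v v \<in> S"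
    and nz: "S \<noteq> {0}"
  obtains e l where "e \<in> S" "norm e = 1" "A *v e = l *\<^sub>R e"
    "\<And>v. v \<in> S \<Longrightarrow> l * (v \<bullet> v) \<le> v \<bullet> (A *v v)"
proof -
  let ?K = "sphere 0 1 \<inter> S"
  obtain u where u: "u \<in> S" "u \<noteq> 0" using nz S subspace_0 by blast
  have "(1 / norm u) *\<^sub>R u \<in> ?K" using u S by (simp add: subspace_scale)
  then have ne: "?K \<noteq> {}" by blast
  have cpt: "compact ?K" by (simp add: S closed_subspace compact_Int_closed)
  have cont: "continuous_on ?K (\<lambda>v. v \<bullet> (A *v v))"
    by (intro continuous_intros linear_continuous_on_compose[OF continuous_on_id]) simp
  obtain e where e: "e \<in> ?K" and min: "\<And>v. v \<in> ?K \<Longrightarrow> e \<bullet> (A *v e) \<le> v \<bullet> (A *v v)"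
    using continuous_attains_inf[OF cpt ne cont] by blast
  define l where "l = e \<bullet> (A *v e)"
  have bound: "l * (v \<bullet> v) \<le> v \<bullet> (A *v v)" if v: "v \<in> S" for v
  proof (cases "v = 0")
    case False
    have "(1 / norm v) *\<^sub>R v \<in> ?K" using v S False by (simp add: subspace_scale)
    from min[OF this] have "l \<le> (v \<bullet> (A *v v)) / (norm v)\<^sup>2"
      by (simp add: l_def matrix_vector_mult_scaleR power2_eq_square)
    then show ?thesis using False by (simp add: field_simps flip: power2_norm_eq_inner)
  qed simp
  define B where "B = A - mat l"
  have Bv: "B *v v = A *v v - l *\<^sub>R v" for v
    by (simp add: B_def matrix_vector_mult_diff_rdistrib mat_mult_vec)
  have "B *v e = 0"
  proof (rule psd_form_zero[OF _ S])
    show "transpose B = B" using A by (auto simp: B_def vec_eq_iff transpose_def mat_def)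
    show "B *v v \<in> S" if "v \<in> S" for v using that inv S by (simp add: Bv subspace_diff subspace_scale)
    show "0 \<le> v \<bullet> (B *v v)" if "v \<in> S" for v using bound[OF that] by (simp add: Bv inner_diff_right)
    show "e \<in> S" using e by simp
    show "e \<bullet> (B *v e) = 0" using e by (simp add: Bv inner_diff_right l_def flip: power2_norm_eq_inner)
  qed
  then have "A *v e = l *\<^sub>R e" by (simp add: Bv)
  with bound e that show ?thesis by (auto simp: dist_norm)
qed

text \<open>Spectral theorem by induction on the dimension: a unit eigenvector from the Rayleigh
  minimum is split off, and symmetry of \<open>A\<close> makes its orthogonal complement in
  \<open>S\<close> invariant.\<close>

lemma symmetric_eigenbasis_subspace:
  fixes A :: "real ^ 'n ^ 'n"
  assumes A: "transpose A = A" and S: "subspace S" and inv: "\<And>v. v \<in> S \<Longrightarrow> A *v v \<in> S"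
  shows "\<exists>E. finite E \<and> E \<subseteq> S \<and> (\<forall>e\<in>E. \<forall>f\<in>E. e \<bullet> f = (if e = f then 1 else 0)) \<and>
    (\<forall>v\<in>S. v = (\<Sum>e\<in>E. (v \<bullet> e) *\<^sub>R e)) \<and> (\<forall>e\<in>E. \<exists>l. A *v e = l *\<^sub>R e)"
  using S inv
proof (induction "dim S" arbitrary: S rule: less_induct)
  case less
  show ?case
  proof (cases "S = {0}")
    case True
    then show ?thesis by (intro exI[of _ "{}"]) simp
  next
    case False
    from rayleigh_minimizer[OF A less.prems(1) less.prems(2) False] obtain e l
      where e: "e \<in> S" "norm e = 1" "A *v e = l *\<^sub>R e" by metis
    have ee: "e \<bullet> e = 1" using e by (simp add: norm_eq_1)
    define T where "T = {v \<in> S. v \<bullet> e = 0}"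
    have T: "subspace T" using less.prems(1)
      by (auto simp: T_def subspace_def inner_add_left)
    have Tinv: "A *v v \<in> T" if "v \<in> T" for v
      using that less.prems(2) e inner_symmetric_matrix[OF A, of v e] by (auto simp: T_def)
    have "e \<notin> T" using ee by (simp add: T_def)
    then have "T \<subset> S" using e(1) unfolding T_def by blast
    then have "dim T < dim S"
      by (metis T dim_psubset less.prems(1) span_eq_iff)
    from less.hyps[OF this T Tinv] obtain E where E: "finite E" "E \<subseteq> T"
      "\<forall>e\<in>E. \<forall>f\<in>E. e \<bullet> f = (if e = f then 1 else 0)" "\<forall>v\<in>T. v = (\<Sum>e\<in>E. (v \<bullet> e) *\<^sub>R e)"
      "\<forall>e\<in>E. \<exists>l. A *v e = l *\<^sub>R e" by auto
    have neE: "e \<notin> E" using E ee by (auto simp: T_def)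
    have orth: "f \<bullet> e = 0" "e \<bullet> f = 0" if "f \<in> E" for f
      using that E by (auto simp: T_def inner_commute)
    have exp: "v = (\<Sum>f\<in>insert e E. (v \<bullet> f) *\<^sub>R f)" if v: "v \<in> S" for v
    proof -
      define w where "w = v - (v \<bullet> e) *\<^sub>R e"
      have "w \<in> T" using v e ee less.prems(1)
        by (auto simp: T_def w_def subspace_diff subspace_scale inner_diff_left)
      then have "w = (\<Sum>f\<in>E. (w \<bullet> f) *\<^sub>R f)" using E by blast
      also have "\<dots> = (\<Sum>f\<in>E. (v \<bullet> f) *\<^sub>R f)"
        by (intro sum.cong) (auto simp: w_def inner_diff_left orth)
      finally show ?thesis using E neE by (simp add: w_def algebra_simps)
    qed
    show ?thesis
    proof (intro exI[of _ "insert e E"] conjI ballI)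
      show "v = (\<Sum>f\<in>insert e E. (v \<bullet> f) *\<^sub>R f)" if "v \<in> S" for v by (rule exp[OF that])
      show "insert e E \<subseteq> S" using E(2) e(1) by (auto simp: T_def)
      show "f \<bullet> g = (if f = g then 1 else 0)" if "f \<in> insert e E" "g \<in> insert e E" for f g
        using that E(3) ee neE orth by auto
    qed (use E(1,5) e(3) in auto)
  qed
qed

section \<open>Inverse matrices and calculus in an orthonormal eigenbasis\<close>

lemma matrix_inv_left:
  fixes A :: "real ^ 'n ^ 'n"
  assumes "invertible A"
  shows "matrix_inv A ** A = mat 1"
  using someI_ex[OF assms[unfolded invertible_def]] by (simp add: matrix_inv_def)

lemma matrix_inv_unique:
  fixes A :: "real ^ 'n ^ 'n"
  assumes "A ** B = mat 1"
  shows "matrix_inv A = B"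
proof -
  have "invertible A" using assms invertible_right_inverse by blast
  then have "matrix_inv A = matrix_inv A ** (A ** B)" using assms by simp
  also have "\<dots> = B" using matrix_inv_left[OF \<open>invertible A\<close>] by (simp add: matrix_mul_assoc)
  finally show ?thesis .
qed

text \<open>The eigenvalues are a function on \<open>E\<close>, so that shifts, squares and inverses
  of \<open>A\<close> keep the basis and change only \<open>\<mu>\<close>. Comparing such matrices
  then reduces to comparing sums over \<open>E\<close> term by term.\<close>

locale eigenbasis =
  fixes A :: "real ^ 'n ^ 'n" and E :: "(real ^ 'n) set" and \<mu> :: "real ^ 'n \<Rightarrow> real"
  assumes finite_E: "finite E"
    and orthonormal: "\<And>e f. e \<in> E \<Longrightarrow> f \<in> E \<Longrightarrow> e \<bullet> f = (if e = f then 1 else 0)"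
    and expansion: "\<And>v. v = (\<Sum>e\<in>E. (v \<bullet> e) *\<^sub>R e)"
    and eigen: "\<And>e. e \<in> E \<Longrightarrow> A *v e = \<mu> e *\<^sub>R e"
begin

lemma mult_vec: "A *v v = (\<Sum>e\<in>E. ((v \<bullet> e) * \<mu> e) *\<^sub>R e)"
proof -
  have "A *v v = A *v (\<Sum>e\<in>E. (v \<bullet> e) *\<^sub>R e)" by (rule arg_cong[OF expansion])
  also have "\<dots> = (\<Sum>e\<in>E. (v \<bullet> e) *\<^sub>R (A *v e))"
    by (simp add: vec.sum matrix_vector_mult_scaleR)
  finally show ?thesis by (simp add: eigen cong: sum.cong)
qed

lemma inner_expansion: "v \<bullet> w = (\<Sum>e\<in>E. (v \<bullet> e) * (w \<bullet> e))"
proof -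
  have "v \<bullet> w = v \<bullet> (\<Sum>e\<in>E. (w \<bullet> e) *\<^sub>R e)" by (rule arg_cong[OF expansion])
  also have "\<dots> = (\<Sum>e\<in>E. (v \<bullet> e) * (w \<bullet> e))" by (simp add: inner_sum_right mult.commute)
  finally show ?thesis .
qed

lemma mult_vec_inner: "e \<in> E \<Longrightarrow> (A *v v) \<bullet> e = \<mu> e * (v \<bullet> e)"
  using finite_E by (simp add: mult_vec inner_sum_left orthonormal if_distrib cong: if_cong)

lemma quadratic_form: "v \<bullet> (A *v v) = (\<Sum>e\<in>E. \<mu> e * (v \<bullet> e)\<^sup>2)"
  by (subst inner_expansion) (simp add: mult_vec_inner power2_eq_square algebra_simps cong: sum.cong)

lemma nonempty_E: "E \<noteq> {}"
proof
  assume "E = {}"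
  have "(1 :: real ^ 'n) = 0" using expansion[of 1] unfolding \<open>E = {}\<close> sum.empty .
  then show False by simp
qed

lemma symmetric: "transpose A = A"
proof -
  have "x \<bullet> (A *v y) = (A *v x) \<bullet> y" for x y
    by (subst (1 2) inner_expansion) (simp add: mult_vec_inner algebra_simps cong: sum.cong)
  then have "axis i 1 \<bullet> (A *v axis j 1) = (A *v axis i 1) \<bullet> axis j 1" for i j .
  then show ?thesis
    by (simp add: vec_eq_iff transpose_def matrix_vector_mul_component inner_axis' inner_axis matrix_vector_mult_basis column_def)
qed

text \<open>The trace does not depend on the orthonormal basis: Parseval for two coordinate vectors
  is the completeness relation \<open>delta\<close>, which collapses the double sum over the entries
  to the diagonal.\<close>

lemma trace_eq: "trace M = (\<Sum>e\<in>E. e \<bullet> (M *v e))"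
proof -
  have "(\<Sum>e\<in>E. e $ i * e $ j) = (if i = j then 1 else 0)" for i j
    using inner_expansion[of "axis i 1" "axis j 1"]
    by (cases "i = j") (simp_all add: inner_axis' inner_axis, simp_all add: axis_def)
  note delta = this
  have "(\<Sum>e\<in>E. e \<bullet> (M *v e)) = (\<Sum>e\<in>E. \<Sum>i\<in>UNIV. \<Sum>j\<in>UNIV. M $ i $ j * (e $ i * e $ j))"
    by (simp add: inner_vec_def matrix_vector_mult_def sum_distrib_left algebra_simps)
  also have "\<dots> = (\<Sum>i\<in>UNIV. \<Sum>e\<in>E. \<Sum>j\<in>UNIV. M $ i $ j * (e $ i * e $ j))"
    by (rule sum.swap)
  also have "\<dots> = (\<Sum>i\<in>UNIV. \<Sum>j\<in>UNIV. \<Sum>e\<in>E. M $ i $ j * (e $ i * e $ j))"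
    by (intro sum.cong refl sum.swap)
  also have "\<dots> = (\<Sum>i\<in>UNIV. \<Sum>j\<in>UNIV. M $ i $ j * (if i = j then 1 else 0))"
    by (simp add: sum_distrib_left[symmetric] delta)
  also have "\<dots> = trace M" by (simp add: trace_def if_distrib cong: if_cong)
  finally show ?thesis ..
qed

lemma trace_eq_sum: "trace A = (\<Sum>e\<in>E. \<mu> e)"
  by (simp add: trace_eq eigen orthonormal cong: sum.cong)

lemma eigenbasis_diff: "eigenbasis (A - mat c) E (\<lambda>e. \<mu> e - c)"
  by (intro eigenbasis.intro finite_E orthonormal expansion)
    (simp_all add: eigen matrix_vector_mult_diff_rdistrib mat_mult_vec scaleR_diff_left)

lemma eigenbasis_power2: "eigenbasis (A ** A) E (\<lambda>e. (\<mu> e)\<^sup>2)"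
  by (intro eigenbasis.intro finite_E orthonormal expansion)
    (simp_all add: eigen matrix_vector_mul_assoc[symmetric] matrix_vector_mult_scaleR power2_eq_square)

lemma invertible_pos:
  assumes "\<And>e. e \<in> E \<Longrightarrow> \<mu> e > 0"
  shows "invertible A"
proof -
  have "x = 0" if "A *v x = 0" for x
  proof -
    have "x \<bullet> e = 0" if "e \<in> E" for e
      using mult_vec_inner[OF that, of x] \<open>A *v x = 0\<close> assms[OF that] by simp
    then have "(\<Sum>e\<in>E. (x \<bullet> e) *\<^sub>R e) = 0" by (intro sum.neutral) simp
    then show ?thesis by (rule trans[OF expansion])
  qed
  then show ?thesis
    by (simp add: invertible_left_inverse matrix_left_invertible_ker)
qed

lemma eigenbasis_inverse:
  assumes "\<And>e. e \<in> E \<Longrightarrow> \<mu> e > 0"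
  shows "eigenbasis (matrix_inv A) E (\<lambda>e. 1 / \<mu> e)"
proof
  fix e assume e: "e \<in> E"
  have "matrix_inv A *v (A *v e) = e"
    using matrix_inv_left[OF invertible_pos[OF assms]] by (simp add: matrix_vector_mul_assoc)
  then have "\<mu> e *\<^sub>R (matrix_inv A *v e) = e" by (simp add: eigen[OF e] matrix_vector_mult_scaleR)
  then have "(1 / \<mu> e) *\<^sub>R (\<mu> e *\<^sub>R (matrix_inv A *v e)) = (1 / \<mu> e) *\<^sub>R e" by simp
  then show "matrix_inv A *v e = (1 / \<mu> e) *\<^sub>R e" using assms[OF e] by simp
qed (use finite_E orthonormal in auto, rule expansion)

end

lemma symmetric_eigenbasis:
  fixes A :: "real ^ 'n ^ 'n"
  assumes "transpose A = A"
  obtains E \<mu> where "eigenbasis A E \<mu>"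
proof -
  from symmetric_eigenbasis_subspace[OF assms subspace_UNIV] obtain E where E: "finite E"
    "\<forall>e\<in>E. \<forall>f\<in>E. e \<bullet> f = (if e = f then 1 else 0)" "\<forall>v. v = (\<Sum>e\<in>E. (v \<bullet> e) *\<^sub>R e)"
    "\<forall>e\<in>E. \<exists>l. A *v e = l *\<^sub>R e" by auto
  from E(4) obtain \<mu> where "\<forall>e\<in>E. A *v e = \<mu> e *\<^sub>R e" by metis
  with E have "eigenbasis A E \<mu>" by unfold_locales auto
  then show ?thesis by (rule that)
qed

text \<open>The minimum of the Rayleigh quotient is attained at an eigenvector and lies below every
  other eigenvalue, so it is the \<open>LEAST\<close> one. The equivalence for lower bounds
  \<open>c\<close> serves both for measurability and for comparison with the barrier.\<close>

lemma lambda_min_rayleigh: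
  fixes A :: "real ^ 'n ^ 'n"
  assumes A: "transpose A = A"
  shows "c \<le> lambda_min A \<longleftrightarrow> (\<forall>v. c * (v \<bullet> v) \<le> v \<bullet> (A *v v))"
proof -
  have "(UNIV :: (real ^ 'n) set) \<noteq> {0}" by (metis UNIV_I singletonD zero_neq_one)
  from rayleigh_minimizer[OF A subspace_UNIV _ this] obtain e l
    where e: "norm e = 1" "A *v e = l *\<^sub>R e" and min: "\<And>v. l * (v \<bullet> v) \<le> v \<bullet> (A *v v)" by auto
  have "lambda_min A = l" unfolding lambda_min_def
  proof (rule Least_equality)
    show "eigenvalue A l" using e by (auto simp: eigenvalue_def intro!: exI[of _ e])
    fix m assume "eigenvalue A m"
    then obtain v where v: "v \<noteq> 0" "A *v v = m *\<^sub>R v" by (auto simp: eigenvalue_def)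
    then show "l \<le> m" using min[of v] by (simp add: v)
  qed
  moreover have "c \<le> l \<longleftrightarrow> (\<forall>v. c * (v \<bullet> v) \<le> v \<bullet> (A *v v))"
  proof
    assume "c \<le> l"
    then show "\<forall>v. c * (v \<bullet> v) \<le> v \<bullet> (A *v v)"
      by (meson inner_ge_zero min mult_right_mono order_trans)
  next
    assume "\<forall>v. c * (v \<bullet> v) \<le> v \<bullet> (A *v v)"
    then have "c * (e \<bullet> e) \<le> e \<bullet> (A *v e)" by blast
    then show "c \<le> l" using e by (simp add: norm_eq_1)
  qed
  ultimately show ?thesis by simp
qed

section \<open>Positive definite matrices\<close>

definition positive_definite :: "real ^ 'n ^ 'n \<Rightarrow> bool" where
  "positive_definite A \<longleftrightarrow> transpose A = A \<and> (\<forall>v. v \<noteq> 0 \<longrightarrow> 0 < v \<bullet> (A *v v))"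

lemma (in eigenbasis) positive_definite_iff:
  "positive_definite A \<longleftrightarrow> (\<forall>e\<in>E. \<mu> e > 0)"
proof
  assume A: "positive_definite A"
  show "\<forall>e\<in>E. \<mu> e > 0"
  proof
    fix e assume e: "e \<in> E"
    then have "e \<noteq> 0" using orthonormal[OF e e] by auto
    then show "\<mu> e > 0" using A eigen[OF e] orthonormal[OF e e] by (auto simp: positive_definite_def)
  qed
next
  assume pos: "\<forall>e\<in>E. \<mu> e > 0"
  have "0 < v \<bullet> (A *v v)" if v: "v \<noteq> 0" for v
  proof -
    have "\<exists>e\<in>E. v \<bullet> e \<noteq> 0"
    proof (rule ccontr)
      assume "\<not> ?thesis"
      then have "(\<Sum>e\<in>E. (v \<bullet> e) *\<^sub>R e) = 0" by (intro sum.neutral) simp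
      then show False using trans[OF expansion] v by blast
    qed
    then obtain e where "e \<in> E" "v \<bullet> e \<noteq> 0" by blast
    then show ?thesis unfolding quadratic_form
      using pos by (intro sum_pos2[OF finite_E, of e]) (auto intro!: mult_nonneg_nonneg mult_pos_pos simp: less_imp_le)
  qed
  then show "positive_definite A" by (simp add: positive_definite_def symmetric)
qed

lemma positive_definite_eigenbasis:
  assumes "positive_definite A"
  obtains E \<mu> where "eigenbasis A E \<mu>" "\<And>e. e \<in> E \<Longrightarrow> \<mu> e > 0"
proof -
  obtain E \<mu> where "eigenbasis A E \<mu>"
    using assms symmetric_eigenbasis by (auto simp: positive_definite_def)
  with eigenbasis.positive_definite_iff[OF this] assms that show ?thesis by blast
qed

section \<open>Rank-one matrices and rank-one updates of the inverse\<close>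

lemma outer_square_mult_vec: "outer_square x *v v = (x \<bullet> v) *\<^sub>R x"
  by (simp add: vec_eq_iff outer_square_def matrix_vector_mult_def inner_vec_def sum_distrib_left
      sum_distrib_right algebra_simps)

lemma transpose_outer_square: "transpose (outer_square x) = outer_square x"
  by (simp add: vec_eq_iff transpose_def outer_square_def)

lemma trace_outer_square: "trace (outer_square x) = x \<bullet> x"
  by (simp add: trace_def outer_square_def inner_vec_def)

lemma trace_scaleR: "trace (c *\<^sub>R A) = c * trace (A :: real ^ 'n ^ 'n)"
  by (simp add: trace_def sum_distrib_left)

text \<open>The Sherman-Morrison formula, checked by applying the product to an arbitrary vector;
  symmetry of the inverse moves it across the inner product.\<close>

lemma matrix_inv_rank_one_update:
  fixes A :: "real ^ 'n ^ 'n"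
  assumes A: "invertible A" and sym: "transpose (matrix_inv A) = matrix_inv A"
    and nz: "1 + x \<bullet> (matrix_inv A *v x) \<noteq> 0"
  shows "matrix_inv (A + outer_square x) =
    matrix_inv A - (1 / (1 + x \<bullet> (matrix_inv A *v x))) *\<^sub>R outer_square (matrix_inv A *v x)"
proof (rule matrix_inv_unique)
  let ?R = "matrix_inv A"
  let ?q = "1 + x \<bullet> (?R *v x)"
  have inv: "A *v (?R *v v) = v" for v
    using someI_ex[OF A[unfolded invertible_def]]
    by (simp add: matrix_inv_def matrix_vector_mul_assoc)
  have "((A + outer_square x) ** (?R - (1 / ?q) *\<^sub>R outer_square (?R *v x))) *v v = mat 1 *v v" for v
  proof -
    have *: "(?R *v x) \<bullet> v = x \<bullet> (?R *v v)" by (rule inner_symmetric_matrix[OF sym, symmetric])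
    have sc: "(c *\<^sub>R B) *v w = c *\<^sub>R (B *v w)" for c and B :: "real ^ 'n ^ 'n" and w
      by (rule scaleR_matrix_vector_assoc[symmetric])
    have "((A + outer_square x) ** (?R - (1 / ?q) *\<^sub>R outer_square (?R *v x))) *v v =
      v + (x \<bullet> (?R *v v)) *\<^sub>R x - (x \<bullet> (?R *v v) / ?q) *\<^sub>R (x + (x \<bullet> (?R *v x)) *\<^sub>R x)"
      by (simp add: matrix_vector_mul_assoc[symmetric] matrix_vector_mult_diff_rdistrib
          matrix_vector_mult_add_rdistrib matrix_vector_mult_diff_distrib sc
          matrix_vector_mult_scaleR outer_square_mult_vec inv * algebra_simps)
    also have "x + (x \<bullet> (?R *v x)) *\<^sub>R x = ?q *\<^sub>R x" by (simp add: algebra_simps)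
    finally show ?thesis using nz by simp
  qed
  then show "(A + outer_square x) ** (?R - (1 / ?q) *\<^sub>R outer_square (?R *v x)) = mat 1"
    unfolding matrix_eq by blast
qed

section \<open>Moving the barrier\<close>

text \<open>\<open>R\<close> stands for the inverse of the current matrix minus the barrier. The
  value 0 leaves the barrier in place when a truncation fails. One factor \<open>1 - s\<close> pays
  for the change of the eigenvalues under the shift, the other for the denominator in the
  Sherman-Morrison formula.\<close>

definition barrier_shift :: "real \<Rightarrow> real \<Rightarrow> real ^ 'n ^ 'n \<Rightarrow> real ^ 'n \<Rightarrow> real" where
  "barrier_shift s \<phi> R x =
    (let q = ((R *v x) \<bullet> (R *v x)) / trace (R ** R)
     in if x \<bullet> (R *v x) \<le> s \<and> q \<le> s / \<phi> then (1 - s)\<^sup>2 * q else 0)"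

text \<open>The trace of the inverse measures how close the barrier is to the whole spectrum; the
  bound forces every eigenvalue of \<open>B\<close> to be at least
  \<open>1 / \<phi>\<close>.\<close>

definition barrier_ok :: "real \<Rightarrow> real ^ 'n ^ 'n \<Rightarrow> bool" where
  "barrier_ok \<phi> B \<longleftrightarrow> positive_definite B \<and> trace (matrix_inv B) \<le> \<phi>"

text \<open>The upper bound is the fraction \<open>s\<close> of the gap \<open>1 / \<phi>\<close>.
  It keeps the shifted matrix positive definite in \<open>barrier_step\<close> and makes the shifts
  bounded, hence integrable.\<close>

lemma barrier_shift_bounds:
  assumes s: "0 < s" "s < 1" and \<phi>: "\<phi> > 0" and B: "positive_definite B"
  shows "0 \<le> barrier_shift s \<phi> (matrix_inv B) x" "barrier_shift s \<phi> (matrix_inv B) x \<le> s / \<phi>"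
proof -
  obtain E \<mu> where "eigenbasis B E \<mu>" and pos: "\<And>e. e \<in> E \<Longrightarrow> \<mu> e > 0"
    using positive_definite_eigenbasis[OF B] by blast
  interpret eigenbasis B E \<mu> by fact
  interpret R: eigenbasis "matrix_inv B" E "\<lambda>e. 1 / \<mu> e" by (rule eigenbasis_inverse[OF pos])
  interpret RR: eigenbasis "matrix_inv B ** matrix_inv B" E "\<lambda>e. (1 / \<mu> e)\<^sup>2"
    by (rule R.eigenbasis_power2)
  have tr: "trace (matrix_inv B ** matrix_inv B) \<ge> 0"
    by (simp add: RR.trace_eq_sum sum_nonneg)
  have "(1 - s)\<^sup>2 \<le> 1" using s by (simp add: power_le_one)
  then have "(1 - s)\<^sup>2 * q \<le> s / \<phi>" if "0 \<le> q" "q \<le> s / \<phi>" for q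
    using mult_right_mono[OF _ that(1), of "(1 - s)\<^sup>2" 1] that by simp
  with tr s \<phi> show "0 \<le> barrier_shift s \<phi> (matrix_inv B) x" "barrier_shift s \<phi> (matrix_inv B) x \<le> s / \<phi>"
    by (auto simp: barrier_shift_def Let_def simp del: times_divide_eq_right)
qed

text \<open>Subtracting the shift raises the trace of the inverse, and adding
  \<open>outer_square x\<close> lowers it by the Sherman-Morrison term. The shift is chosen so that
  the second effect covers the first.\<close>

lemma barrier_step:
  fixes B :: "real ^ 'n ^ 'n"
  assumes s: "0 < s" "s < 1" and ok: "barrier_ok \<phi> B"
  shows "barrier_ok \<phi> (B - mat (barrier_shift s \<phi> (matrix_inv B) x) + outer_square x)"
proof -
  have pd: "positive_definite B" and tr: "trace (matrix_inv B) \<le> \<phi>"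
    using ok by (auto simp: barrier_ok_def)
  obtain E \<mu> where "eigenbasis B E \<mu>" and pos: "\<And>e. e \<in> E \<Longrightarrow> \<mu> e > 0"
    using positive_definite_eigenbasis[OF pd] by blast
  interpret eigenbasis B E \<mu> by fact
  interpret R: eigenbasis "matrix_inv B" E "\<lambda>e. 1 / \<mu> e" by (rule eigenbasis_inverse[OF pos])
  interpret RR: eigenbasis "matrix_inv B ** matrix_inv B" E "\<lambda>e. (1 / \<mu> e)\<^sup>2"
    by (rule R.eigenbasis_power2)
  define T where "T = (\<Sum>e\<in>E. (1 / \<mu> e)\<^sup>2)"
  have sq_pos: "(1 / \<mu> e)\<^sup>2 > 0" if "e \<in> E" for e using pos[OF that] by simp
  have T: "T > 0" unfolding T_def using finite_E nonempty_E sq_pos by (intro sum_pos) auto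
  have sum_le: "(\<Sum>e\<in>E. 1 / \<mu> e) \<le> \<phi>" using tr by (simp add: R.trace_eq_sum)
  have inv_le: "1 / \<mu> e \<le> \<phi>" if "e \<in> E" for e
    by (rule order_trans[OF member_le_sum sum_le]) (use that finite_E pos in \<open>auto intro: less_imp_le\<close>)
  have \<phi>: "\<phi> > 0"
    using nonempty_E inv_le pos by (metis all_not_in_conv divide_pos_pos less_le_trans zero_less_one)
  define d where "d = barrier_shift s \<phi> (matrix_inv B) x"
  note d = barrier_shift_bounds[OF s \<phi> pd, of x, folded d_def]
  define \<nu> where "\<nu> e = \<mu> e - d" for e
  \<comment> \<open>The shift is at most \<open>s / \<phi>\<close> and each eigenvalue at least
    \<open>1 / \<phi>\<close>, so at most the fraction \<open>s\<close> of any eigenvalue is used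
    up.\<close>
  have \<nu>: "(1 - s) * \<mu> e \<le> \<nu> e" "\<nu> e \<le> \<mu> e" "0 < \<nu> e" if e: "e \<in> E" for e
  proof -
    have "s / \<phi> \<le> s * \<mu> e" using inv_le[OF e] pos[OF e] \<phi> s by (simp add: field_simps)
    then show "(1 - s) * \<mu> e \<le> \<nu> e" using d by (simp add: \<nu>_def algebra_simps)
    moreover have "(1 - s) * \<mu> e > 0" using pos[OF e] s by simp
    ultimately show "0 < \<nu> e" by simp
    show "\<nu> e \<le> \<mu> e" using d by (simp add: \<nu>_def)
  qed
  interpret D: eigenbasis "B - mat d" E \<nu> unfolding \<nu>_def by (rule eigenbasis_diff)
  interpret S: eigenbasis "matrix_inv (B - mat d)" E "\<lambda>e. 1 / \<nu> e"
    by (rule D.eigenbasis_inverse[OF \<nu>(3)])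
  let ?S = "matrix_inv (B - mat d)"
  have normsq: "(M *v x) \<bullet> (M *v x) = (\<Sum>e\<in>E. (1 / \<kappa> e)\<^sup>2 * (x \<bullet> e)\<^sup>2)"
    if "eigenbasis M E (\<lambda>e. 1 / \<kappa> e)" for M :: "real ^ 'n ^ 'n" and \<kappa>
  proof -
    interpret M: eigenbasis M E "\<lambda>e. 1 / \<kappa> e" by fact
    interpret MM: eigenbasis "M ** M" E "\<lambda>e. (1 / \<kappa> e)\<^sup>2" by (rule M.eigenbasis_power2)
    have "(M *v x) \<bullet> (M *v x) = x \<bullet> ((M ** M) *v x)"
      by (simp add: inner_symmetric_matrix[OF M.symmetric, of x] matrix_vector_mul_assoc[symmetric])
    then show ?thesis by (simp add: MM.quadratic_form)
  qed
  define q where "q = x \<bullet> (?S *v x)"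
  have q0: "q \<ge> 0" unfolding q_def S.quadratic_form
    by (intro sum_nonneg mult_nonneg_nonneg) (auto intro: less_imp_le \<nu>)
  have key: "(\<Sum>e\<in>E. 1 / \<nu> e) - (\<Sum>e\<in>E. 1 / \<mu> e) \<le> ((?S *v x) \<bullet> (?S *v x)) / (1 + q)"
  proof (cases "d = 0")
    case True
    then show ?thesis using q0 by (simp add: \<nu>_def)
  next
    case False
    let ?p = "(matrix_inv B *v x) \<bullet> (matrix_inv B *v x)"
    \<comment> \<open>A nonzero shift can only come from the branch where both truncations
      hold.\<close>
    have c: "x \<bullet> (matrix_inv B *v x) \<le> s" and dT: "d * T = (1 - s)\<^sup>2 * ?p"
      using False T unfolding d_def barrier_shift_def RR.trace_eq_sum T_def[symmetric]
      by (auto simp: Let_def split: if_splits)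
    have "1 / \<nu> e - 1 / \<mu> e \<le> d / (1 - s) * (1 / \<mu> e)\<^sup>2" if e: "e \<in> E" for e
    proof -
      have "1 / \<nu> e - 1 / \<mu> e = d / (\<nu> e * \<mu> e)"
        using pos[OF e] \<nu>(3)[OF e] by (simp add: \<nu>_def field_simps)
      also have "\<dots> \<le> d / ((1 - s) * \<mu> e * \<mu> e)"
        using \<nu>[OF e] pos[OF e] s d by (intro divide_left_mono mult_right_mono) auto
      finally show ?thesis by (simp add: power2_eq_square)
    qed
    then have "(\<Sum>e\<in>E. 1 / \<nu> e - 1 / \<mu> e) \<le> d / (1 - s) * T"
      unfolding T_def sum_distrib_left by (rule sum_mono)
    also have "\<dots> = (d * T) / (1 - s)" by simp
    also have "\<dots> = (1 - s) * ?p" using s by (simp add: dT power2_eq_square)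
    \<comment> \<open>Passing from \<open>matrix_inv B\<close> to \<open>?S\<close> increases every
      coefficient, since \<open>\<nu> e \<le> \<mu> e\<close>.\<close>
    also have "\<dots> \<le> (1 - s) * ((?S *v x) \<bullet> (?S *v x))"
      unfolding normsq[OF R.eigenbasis_axioms] normsq[OF S.eigenbasis_axioms]
      using s \<nu> pos by (intro mult_left_mono sum_mono mult_right_mono power_mono divide_left_mono)
        (auto intro: less_imp_le mult_pos_pos)
    \<comment> \<open>The truncation bounds the form of \<open>matrix_inv B\<close>. Since the
      eigenvalues shrink by at most the factor \<open>1 - s\<close>, it also gives
      \<open>(1 - s) * q \<le> s\<close>, which is the same as
      \<open>1 - s \<le> 1 / (1 + q)\<close>.\<close>
    also have "\<dots> \<le> ((?S *v x) \<bullet> (?S *v x)) / (1 + q)"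
    proof -
      have "(1 - s) * q \<le> (\<Sum>e\<in>E. 1 / \<mu> e * (x \<bullet> e)\<^sup>2)"
        unfolding q_def S.quadratic_form sum_distrib_left
      proof (rule sum_mono)
        fix e assume e: "e \<in> E"
        have "(1 - s) * (1 / \<nu> e) \<le> 1 / \<mu> e" using \<nu>[OF e] pos[OF e] by (simp add: field_simps)
        from mult_right_mono[OF this, of "(x \<bullet> e)\<^sup>2"]
        show "(1 - s) * (1 / \<nu> e * (x \<bullet> e)\<^sup>2) \<le> 1 / \<mu> e * (x \<bullet> e)\<^sup>2" by simp
      qed
      also have "\<dots> \<le> s" using c by (simp add: R.quadratic_form)
      finally have "(1 - s) * (1 + q) \<le> 1" by (simp add: algebra_simps)
      then have "((1 - s) * (1 + q)) * ((?S *v x) \<bullet> (?S *v x)) \<le> 1 * ((?S *v x) \<bullet> (?S *v x))"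
        by (rule mult_right_mono) simp
      then show ?thesis using q0 by (simp add: field_simps)
    qed
    finally show ?thesis by (simp add: sum_subtractf)
  qed
  have "matrix_inv (B - mat d + outer_square x) = ?S - (1 / (1 + q)) *\<^sub>R outer_square (?S *v x)"
    unfolding q_def by (rule matrix_inv_rank_one_update)
      (use q0 q_def D.invertible_pos[OF \<nu>(3)] S.symmetric in auto)
  then have "trace (matrix_inv (B - mat d + outer_square x)) =
      (\<Sum>e\<in>E. 1 / \<nu> e) - ((?S *v x) \<bullet> (?S *v x)) / (1 + q)"
    by (simp add: trace_sub trace_scaleR trace_outer_square S.trace_eq_sum)
  also have "\<dots> \<le> \<phi>" using key sum_le by simp
  finally have "trace (matrix_inv (B - mat d + outer_square x)) \<le> \<phi>" .
  moreover have "positive_definite (B - mat d + outer_square x)"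
    unfolding positive_definite_def
  proof (intro conjI allI impI)
    show "transpose (B - mat d + outer_square x) = B - mat d + outer_square x"
      using D.symmetric transpose_outer_square[of x]
      by (simp add: vec_eq_iff transpose_def)
    fix v :: "real ^ 'n" assume "v \<noteq> 0"
    then have "0 < v \<bullet> ((B - mat d) *v v)"
      using D.positive_definite_iff \<nu>(3) by (simp add: positive_definite_def)
    moreover have "0 \<le> v \<bullet> (outer_square x *v v)"
      by (simp add: outer_square_mult_vec inner_commute)
    ultimately show "0 < v \<bullet> ((B - mat d + outer_square x) *v v)"
      by (simp add: matrix_vector_mult_add_rdistrib inner_add_right)
  qed
  ultimately show ?thesis by (simp add: barrier_ok_def d_def)
qed

section \<open>Measurability of matrix functions\<close>

lemma borel_measurable_vec_lambda:
  fixes f :: "'n::finite \<Rightarrow> 'a \<Rightarrow> 'b::euclidean_space"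
  assumes "\<And>i. f i \<in> borel_measurable M"
  shows "(\<lambda>\<omega>. \<chi> i. f i \<omega>) \<in> borel_measurable M"
proof (rule borel_measurable_euclidean_space[THEN iffD2], rule ballI)
  fix b :: "'b ^ 'n" assume "b \<in> Basis"
  show "(\<lambda>\<omega>. (\<chi> i. f i \<omega>) \<bullet> b) \<in> borel_measurable M"
    unfolding inner_vec_def vec_lambda_beta
    using assms by measurable
qed

lemma borel_measurable_vec_nth:
  fixes f :: "'a \<Rightarrow> 'b::euclidean_space ^ 'n"
  assumes "f \<in> borel_measurable M"
  shows "(\<lambda>\<omega>. f \<omega> $ i) \<in> borel_measurable M"
  using borel_measurable_continuous_onI[of "\<lambda>v. v $ i"] assms
  by (rule measurable_compose_rev) (intro continuous_intros)

lemma borel_measurable_matrix_vector_mult: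
  fixes A :: "'a \<Rightarrow> real ^ 'n ^ 'm"
  assumes "A \<in> borel_measurable M" "x \<in> borel_measurable M"
  shows "(\<lambda>\<omega>. A \<omega> *v x \<omega>) \<in> borel_measurable M"
  unfolding matrix_vector_mult_def using assms
  by (intro borel_measurable_vec_lambda borel_measurable_sum borel_measurable_times borel_measurable_vec_nth)

lemma borel_measurable_matrix_mult:
  fixes A :: "'a \<Rightarrow> real ^ 'n ^ 'm" and B :: "'a \<Rightarrow> real ^ 'k ^ 'n"
  assumes "A \<in> borel_measurable M" "B \<in> borel_measurable M"
  shows "(\<lambda>\<omega>. A \<omega> ** B \<omega>) \<in> borel_measurable M"
  unfolding matrix_matrix_mult_def using assms
  by (intro borel_measurable_vec_lambda borel_measurable_sum borel_measurable_times borel_measurable_vec_nth)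

lemma borel_measurable_trace:
  fixes A :: "'a \<Rightarrow> real ^ 'n ^ 'n"
  assumes "A \<in> borel_measurable M"
  shows "(\<lambda>\<omega>. trace (A \<omega>)) \<in> borel_measurable M"
  unfolding trace_def using assms by (intro borel_measurable_sum borel_measurable_vec_nth)

lemma borel_measurable_det:
  fixes A :: "'a \<Rightarrow> real ^ 'n ^ 'n"
  assumes "A \<in> borel_measurable M"
  shows "(\<lambda>\<omega>. det (A \<omega>)) \<in> borel_measurable M"
  unfolding det_def using assms
  by (intro borel_measurable_sum borel_measurable_prod borel_measurable_times borel_measurable_vec_nth)
    auto

lemma borel_measurable_outer_square:
  assumes "x \<in> borel_measurable M"
  shows "(\<lambda>\<omega>. outer_square (x \<omega>)) \<in> borel_measurable M"
  unfolding outer_square_def using assms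
  by (intro borel_measurable_vec_lambda borel_measurable_times borel_measurable_vec_nth)

lemma borel_measurable_mat:
  fixes c :: "'a \<Rightarrow> real"
  assumes "c \<in> borel_measurable M"
  shows "(\<lambda>\<omega>. mat (c \<omega>) :: real ^ 'n ^ 'n) \<in> borel_measurable M"
  unfolding mat_def by (intro borel_measurable_vec_lambda) (use assms in measurable)

text \<open>Cramer's rule for each column of the inverse; quotients of determinants are visibly
  measurable in the entries.\<close>

lemma matrix_inv_cramer:
  fixes A :: "real ^ 'n ^ 'n"
  assumes "det A \<noteq> 0"
  shows "matrix_inv A = (\<chi> i j. det (\<chi> k l. if l = i then axis j 1 $ k else A $ k $ l) / det A)"
proof -
  have "invertible A" using assms by (simp add: invertible_det_nz)
  from someI_ex[OF this[unfolded invertible_def]] have "A ** matrix_inv A = mat 1"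
    by (simp add: matrix_inv_def)
  then have "A *v (matrix_inv A *v axis j 1) = axis j 1" for j
    by (simp add: matrix_vector_mul_assoc)
  then have "matrix_inv A *v axis j 1 =
      (\<chi> i. det (\<chi> k l. if l = i then axis j 1 $ k else A $ k $ l) / det A)" for j
    using cramer[OF assms] by blast
  then have "column j (matrix_inv A) =
      (\<chi> i. det (\<chi> k l. if l = i then axis j 1 $ k else A $ k $ l) / det A)" for j
    by (simp add: matrix_vector_mult_basis)
  then show ?thesis by (simp add: vec_eq_iff column_def)
qed

text \<open>On singular matrices \<open>matrix_inv\<close> chooses from an unsatisfiable predicate,
  so it takes one fixed value there. The function is thus Cramer's formula glued to a constant along
  the measurable set where the determinant vanishes.\<close>

lemma borel_measurable_matrix_inv:
  fixes A :: "'a \<Rightarrow> real ^ 'n ^ 'n"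
  assumes A: "A \<in> borel_measurable M"
  shows "(\<lambda>\<omega>. matrix_inv (A \<omega>)) \<in> borel_measurable M"
proof -
  have "matrix_inv A = (SOME x. False)" if "det A = 0" for A :: "real ^ 'n ^ 'n"
  proof -
    have "\<not> (A ** B = mat 1 \<and> B ** A = mat 1)" for B
      using that invertible_det_nz[of A] by (auto simp: invertible_def)
    then have "(\<lambda>B. A ** B = mat 1 \<and> B ** A = mat 1) = (\<lambda>x. False)" by blast
    then show ?thesis unfolding matrix_inv_def by (rule arg_cong)
  qed
  then have eq: "matrix_inv (A \<omega>) = (if det (A \<omega>) = 0 then (SOME x. False)
      else (\<chi> i j. det (\<chi> k l. if l = i then axis j 1 $ k else A \<omega> $ k $ l) / det (A \<omega>)))" for \<omega>
    by (simp add: matrix_inv_cramer)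
  have "(\<lambda>\<omega>. if l = i then axis j 1 $ k else A \<omega> $ k $ l) \<in> borel_measurable M" for i j k l
    using A by (cases "l = i") (simp_all add: borel_measurable_vec_nth)
  then have "(\<lambda>\<omega>. \<chi> i j. det (\<chi> k l. if l = i then axis j 1 $ k else A \<omega> $ k $ l) / det (A \<omega>))
      \<in> borel_measurable M"
    by (intro borel_measurable_vec_lambda borel_measurable_divide borel_measurable_det A)
  moreover note [measurable] = borel_measurable_det[OF A]
  have "{\<omega> \<in> space M. det (A \<omega>) = 0} \<in> sets M" by measurable
  ultimately show ?thesis unfolding eq by (intro measurable_If measurable_const) simp_all
qed

lemma borel_measurable_barrier_shift:
  assumes "R \<in> borel_measurable M" "x \<in> borel_measurable M"
  shows "(\<lambda>\<omega>. barrier_shift s \<phi> (R \<omega>) (x \<omega>)) \<in> borel_measurable M"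
proof -
  note [measurable] = assms borel_measurable_matrix_vector_mult[OF assms]
    borel_measurable_trace[OF borel_measurable_matrix_mult[OF assms(1) assms(1)]]
  show ?thesis unfolding barrier_shift_def Let_def by measurable
qed

text \<open>The Rayleigh inequality is a closed condition on \<open>v\<close>, so it suffices to
  test a countable dense set, and the sets where \<open>lambda_min\<close> is at least
  \<open>c\<close> become countable intersections.\<close>

lemma borel_measurable_lambda_min:
  fixes A :: "'a \<Rightarrow> real ^ 'n ^ 'n"
  assumes A: "A \<in> borel_measurable M" and sym: "\<And>\<omega>. transpose (A \<omega>) = A \<omega>"
  shows "(\<lambda>\<omega>. lambda_min (A \<omega>)) \<in> borel_measurable M"
proof -
  obtain D :: "(real ^ 'n) set" where D: "countable D" "UNIV \<subseteq> closure D"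
    using separable[of "UNIV :: (real ^ 'n) set"] by metis
  have eq: "c \<le> lambda_min (A \<omega>) \<longleftrightarrow> (\<forall>v\<in>D. c * (v \<bullet> v) \<le> v \<bullet> (A \<omega> *v v))" for c \<omega>
  proof -
    let ?S = "{v. c * (v \<bullet> v) \<le> v \<bullet> (A \<omega> *v v)}"
    have "closed ?S"
      by (intro closed_Collect_le continuous_intros linear_continuous_on_compose[OF continuous_on_id]) simp
    then have "D \<subseteq> ?S \<Longrightarrow> ?S = UNIV" using closure_minimal[of D ?S] D(2) by blast
    then show ?thesis unfolding lambda_min_rayleigh[OF sym] by blast
  qed
  have [measurable]: "(\<lambda>\<omega>. A \<omega> *v v) \<in> borel_measurable M" for v
    by (intro borel_measurable_matrix_vector_mult A) simp
  have "{\<omega> \<in> space M. c * (v \<bullet> v) \<le> v \<bullet> (A \<omega> *v v)} \<in> sets M" for c v by measurable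
  then show ?thesis
    unfolding borel_measurable_iff_ge eq
    by (intro allI sets.sets_Collect_countable_All'[OF _ D(1)])
qed

section \<open>Expected shift\<close>

text \<open>Jensen's inequality for the power function: the tangent at the mean lies below the
  graph, and its linear term averages to zero because the weights sum to 1.\<close>

lemma powr_weighted_mean_le:
  fixes w y :: "'b \<Rightarrow> real"
  assumes E: "finite E" and w: "\<And>e. e \<in> E \<Longrightarrow> 0 \<le> w e" "sum w E = 1"
    and y: "\<And>e. e \<in> E \<Longrightarrow> 0 \<le> y e" and p: "p \<ge> 1"
  shows "(\<Sum>e\<in>E. w e * y e) powr p \<le> (\<Sum>e\<in>E. w e * y e powr p)"
proof (cases "(\<Sum>e\<in>E. w e * y e) = 0")
  case True
  then show ?thesis using w y by (simp add: sum_nonneg)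
next
  case False
  define m where "m = (\<Sum>e\<in>E. w e * y e)"
  have m: "m > 0" using False w y by (simp add: m_def less_le sum_nonneg)
  \<comment> \<open>Compare with the tangent of the power function at the mean; the convexity lemma in the
    library excludes the argument 0.\<close>
  have tangent: "m powr p + p * m powr (p - 1) * (t - m) \<le> t powr p" if t: "t \<ge> 0" for t
  proof (cases "t = 0")
    case True
    have "m powr (p - 1) * m = m powr p" using m by (simp add: powr_diff)
    then have "m powr p + p * m powr (p - 1) * (0 - m) = (1 - p) * m powr p"
      by (simp add: algebra_simps)
    also have "\<dots> \<le> 0" using p by (simp add: mult_nonpos_nonneg)
    finally show ?thesis using True by simp
  next
    case False
    have "t powr p - m powr p \<ge> (p * m powr (p - 1)) * (t - m)"
    proof (rule convex_on_imp_above_tangent[OF powr_convex[OF p]])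
      show "((\<lambda>x. x powr p) has_real_derivative p * m powr (p - 1)) (at m within {0<..})"
        by (rule has_field_derivative_at_within)
          (use m in \<open>auto intro!: derivative_eq_intros simp: powr_diff\<close>)
    qed (use m t False in \<open>auto simp: interior_open\<close>)
    then show ?thesis by simp
  qed
  have "m powr p = (\<Sum>e\<in>E. w e * (m powr p + p * m powr (p - 1) * (y e - m)))"
  proof -
    have "(\<Sum>e\<in>E. w e * (m powr p + p * m powr (p - 1) * (y e - m))) =
      (\<Sum>e\<in>E. (m powr p - p * m powr (p - 1) * m) * w e + p * m powr (p - 1) * (w e * y e))"
      by (simp add: algebra_simps)
    also have "\<dots> = (m powr p - p * m powr (p - 1) * m) * sum w E
        + p * m powr (p - 1) * (\<Sum>e\<in>E. w e * y e)"
      unfolding sum.distrib sum_distrib_left ..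
    finally have "(\<Sum>e\<in>E. w e * (m powr p + p * m powr (p - 1) * (y e - m))) = \<dots>" .
    then show ?thesis by (simp add: w m_def)
  qed
  also have "\<dots> \<le> (\<Sum>e\<in>E. w e * y e powr p)"
    using w y tangent by (intro sum_mono mult_left_mono) auto
  finally show ?thesis by (simp add: m_def)
qed

text \<open>The square is a bounded linear functional of \<open>outer_square\<close>, so it commutes
  with the matrix-valued Bochner integral.\<close>

lemma isotropic_second_moment:
  fixes Y :: "'a \<Rightarrow> real ^ 'n"
  assumes "isotropic M Y"
  shows "integrable M (\<lambda>\<omega>. (Y \<omega> \<bullet> v)\<^sup>2)" "(\<integral>\<omega>. (Y \<omega> \<bullet> v)\<^sup>2 \<partial>M) = v \<bullet> v"
proof -
  have int: "integrable M (\<lambda>\<omega>. outer_square (Y \<omega>))"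
    and eq: "(\<integral>\<omega>. outer_square (Y \<omega>) \<partial>M) = mat 1"
    using assms by (auto simp: isotropic_def)
  have bl: "bounded_linear (\<lambda>A :: real ^ 'n ^ 'n. v \<bullet> (A *v v))"
    by (rule linear_conv_bounded_linear[THEN iffD1, OF linearI])
      (simp_all add: matrix_vector_mult_add_rdistrib inner_add_right scaleR_matrix_vector_assoc[symmetric])
  have sq: "(Y \<omega> \<bullet> v)\<^sup>2 = v \<bullet> (outer_square (Y \<omega>) *v v)" for \<omega>
    by (simp add: outer_square_mult_vec power2_eq_square inner_commute)
  show "integrable M (\<lambda>\<omega>. (Y \<omega> \<bullet> v)\<^sup>2)"
    unfolding sq by (rule integrable_bounded_linear[OF bl int])
  show "(\<integral>\<omega>. (Y \<omega> \<bullet> v)\<^sup>2 \<partial>M) = v \<bullet> v"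
    unfolding sq integral_bounded_linear[OF bl int] eq by simp
qed

text \<open>In the eigenbasis both truncated quantities are, up to factors, weighted means of the
  numbers \<open>(Y \<omega> \<bullet> e)\<^sup>2\<close>. Jensen bounds their powers by averages of
  one-dimensional moments, each at most \<open>C\<close> in expectation, and a Markov argument turns
  this into a bound on the truncation loss.\<close>

lemma (in prob_space) expectation_barrier_shift:
  fixes Y :: "'a \<Rightarrow> real ^ 'n" and B :: "real ^ 'n ^ 'n"
  assumes iso: "isotropic M Y" and \<eta>: "\<eta> > 0" and C: "C \<ge> 0"
    and mom: "\<And>x. norm x = 1 \<Longrightarrow> (\<integral>\<^sup>+\<omega>. ennreal (\<bar>Y \<omega> \<bullet> x\<bar> powr (2 + \<eta>)) \<partial>M) \<le> ennreal C"
    and s: "0 < s" "s < 1" and \<phi>: "\<phi> > 0" and ok: "barrier_ok \<phi> B"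
  shows "(1 - s)\<^sup>2 * (1 - 2 * C * (\<phi> / s) powr (\<eta> / 2)) \<le>
    (\<integral>\<omega>. barrier_shift s \<phi> (matrix_inv B) (Y \<omega>) \<partial>M)"
proof -
  have Y[measurable]: "Y \<in> borel_measurable M" using iso by (simp add: isotropic_def)
  have pd: "positive_definite B" and tr: "trace (matrix_inv B) \<le> \<phi>"
    using ok by (auto simp: barrier_ok_def)
  obtain E \<mu> where "eigenbasis B E \<mu>" and pos: "\<And>e. e \<in> E \<Longrightarrow> \<mu> e > 0"
    using positive_definite_eigenbasis[OF pd] by blast
  interpret eigenbasis B E \<mu> by fact
  interpret R: eigenbasis "matrix_inv B" E "\<lambda>e. 1 / \<mu> e" by (rule eigenbasis_inverse[OF pos])
  interpret RR: eigenbasis "matrix_inv B ** matrix_inv B" E "\<lambda>e. (1 / \<mu> e)\<^sup>2"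
    by (rule R.eigenbasis_power2)
  define p where "p = 1 + \<eta> / 2"
  define t where "t = (\<Sum>e\<in>E. 1 / \<mu> e)"
  define T where "T = (\<Sum>e\<in>E. (1 / \<mu> e)\<^sup>2)"
  have t: "t > 0" unfolding t_def using finite_E nonempty_E pos by (intro sum_pos) auto
  have T: "T > 0" unfolding T_def
    by (intro sum_pos finite_E nonempty_E) (use pos in force)
  have t\<phi>: "t \<le> \<phi>" using tr by (simp add: R.trace_eq_sum t_def)
  \<comment> \<open>The normalized eigenvalues of the inverse and of its square serve as probability
    weights on \<open>E\<close>.\<close>
  define v where "v e = 1 / \<mu> e / t" for e
  define w where "w e = (1 / \<mu> e)\<^sup>2 / T" for e
  have v: "v e \<ge> 0" and w: "w e \<ge> 0" if "e \<in> E" for e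
    using pos[OF that] t T by (simp_all add: v_def w_def)
  have v1: "sum v E = 1"
    using t unfolding v_def sum_divide_distrib[symmetric] t_def[symmetric] by simp
  have w1: "sum w E = 1"
    using T unfolding w_def sum_divide_distrib[symmetric] T_def[symmetric] by simp
  \<comment> \<open>Here \<open>a\<close> is the quotient in the shift before truncation, of mean 1
    by isotropy, and \<open>t * b\<close> is the quadratic form that is compared with
    \<open>s\<close>.\<close>
  define a where "a \<omega> = (\<Sum>e\<in>E. w e * (Y \<omega> \<bullet> e)\<^sup>2)" for \<omega>
  define b where "b \<omega> = (\<Sum>e\<in>E. v e * (Y \<omega> \<bullet> e)\<^sup>2)" for \<omega>
  define G where "G \<omega> = (\<Sum>e\<in>E. (v e + w e) * \<bar>Y \<omega> \<bullet> e\<bar> powr (2 + \<eta>))" for \<omega>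
  have q1: "Y \<omega> \<bullet> (matrix_inv B *v Y \<omega>) = t * b \<omega>" for \<omega>
    using t by (simp add: R.quadratic_form b_def v_def sum_distrib_left)
  have "(matrix_inv B *v Y \<omega>) \<bullet> (matrix_inv B *v Y \<omega>) = T * a \<omega>" for \<omega>
  proof -
    have "(matrix_inv B *v Y \<omega>) \<bullet> (matrix_inv B *v Y \<omega>) =
        Y \<omega> \<bullet> ((matrix_inv B ** matrix_inv B) *v Y \<omega>)"
      by (simp add: inner_symmetric_matrix[OF R.symmetric, of "Y \<omega>"] matrix_vector_mul_assoc[symmetric])
    then show ?thesis using T by (simp add: RR.quadratic_form a_def w_def sum_distrib_left)
  qed
  then have shift: "barrier_shift s \<phi> (matrix_inv B) (Y \<omega>) =
      (if t * b \<omega> \<le> s \<and> a \<omega> \<le> s / \<phi> then (1 - s)\<^sup>2 * a \<omega> else 0)" for \<omega>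
    using T by (simp add: barrier_shift_def Let_def q1 RR.trace_eq_sum T_def[symmetric])
  have a0: "a \<omega> \<ge> 0" and b0: "b \<omega> \<ge> 0" for \<omega>
    using v w by (auto simp: a_def b_def intro!: sum_nonneg)
  have pw: "z\<^sup>2 powr p = \<bar>z\<bar> powr (2 + \<eta>)" for z :: real
  proof (cases "z = 0")
    case False
    then have "z\<^sup>2 powr p = (\<bar>z\<bar> powr 2) powr p" by simp
    also have "\<dots> = \<bar>z\<bar> powr (2 * p)" by (rule powr_powr)
    also have "2 * p = 2 + \<eta>" by (simp add: p_def)
    finally show ?thesis .
  qed simp
  have G: "a \<omega> powr p + b \<omega> powr p \<le> G \<omega>" for \<omega>
  proof -
    have "a \<omega> powr p \<le> (\<Sum>e\<in>E. w e * ((Y \<omega> \<bullet> e)\<^sup>2) powr p)" unfolding a_def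
      by (rule powr_weighted_mean_le) (use finite_E w w1 \<eta> in \<open>auto simp: p_def\<close>)
    moreover have "b \<omega> powr p \<le> (\<Sum>e\<in>E. v e * ((Y \<omega> \<bullet> e)\<^sup>2) powr p)" unfolding b_def
      by (rule powr_weighted_mean_le) (use finite_E v v1 \<eta> in \<open>auto simp: p_def\<close>)
    ultimately show ?thesis by (simp add: G_def pw ring_distribs sum.distrib)
  qed
  have G0: "G \<omega> \<ge> 0" for \<omega> by (rule order_trans[OF _ G]) simp
  let ?r = "(\<phi> / s) powr (\<eta> / 2)"
  \<comment> \<open>A bound linear in \<open>a\<close> and \<open>G\<close> at every outcome, so
    that only linearity of the integral remains. Where a truncation fails, the left side has to be
    nonpositive.\<close>
  have pointwise: "(1 - s)\<^sup>2 * (a \<omega> - ?r * G \<omega>) \<le> barrier_shift s \<phi> (matrix_inv B) (Y \<omega>)" for \<omega>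
  proof (cases "t * b \<omega> \<le> s \<and> a \<omega> \<le> s / \<phi>")
    case True
    have "a \<omega> - ?r * G \<omega> \<le> a \<omega>" using G0 by simp
    then show ?thesis using True by (simp add: shift mult_left_mono)
  next
    case False
    \<comment> \<open>Markov: a violated truncation forces \<open>m > s / \<phi>\<close>, hence \<open>m \<le> m\<^sup>p (\<phi> / s)\<^bsup>p - 1\<^esup>\<close>.\<close>
    define m where "m = max (a \<omega>) (b \<omega>)"
    have "b \<omega> > s / \<phi>" if "t * b \<omega> > s"
    proof -
      have "\<phi> * b \<omega> > s" using that t\<phi> b0[of \<omega>] mult_right_mono by (meson less_le_trans)
      then show ?thesis using \<phi> by (simp add: field_simps)
    qed
    then have m: "m > s / \<phi>" using False by (auto simp: m_def)
    have sf: "s / \<phi> > 0" using s \<phi> by simp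
    have m0: "m > 0" using m sf by simp
    have "1 \<le> (m * (\<phi> / s)) powr (\<eta> / 2)"
      using m s \<phi> \<eta> by (intro ge_one_powr_ge_zero) (auto simp: field_simps)
    then have "m * 1 \<le> m * (m * (\<phi> / s)) powr (\<eta> / 2)"
      using m sf by (intro mult_left_mono) auto
    also have "\<dots> = ?r * m powr p"
      using m0 s \<phi> by (simp add: p_def powr_mult powr_add del: times_divide_eq_right)
    also have "m powr p \<le> a \<omega> powr p + b \<omega> powr p" by (simp add: m_def max_def)
    also note G
    finally have "a \<omega> \<le> ?r * G \<omega>" by (simp add: m_def mult_left_mono)
    then have "(1 - s)\<^sup>2 * (a \<omega> - ?r * G \<omega>) \<le> 0" by (intro mult_nonneg_nonpos) simp_all
    then show ?thesis unfolding shift if_not_P[OF False] .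
  qed
  have norm_e: "norm e = 1" if "e \<in> E" for e using orthonormal[OF that that] by (simp add: norm_eq_1)
  have int_pow: "integrable M (\<lambda>\<omega>. \<bar>Y \<omega> \<bullet> e\<bar> powr (2 + \<eta>))"
    and le_pow: "(\<integral>\<omega>. \<bar>Y \<omega> \<bullet> e\<bar> powr (2 + \<eta>) \<partial>M) \<le> C" if e: "e \<in> E" for e
  proof -
    note mom[OF norm_e[OF e]]
    moreover show int: "integrable M (\<lambda>\<omega>. \<bar>Y \<omega> \<bullet> e\<bar> powr (2 + \<eta>))"
      by (rule integrableI_bounded) (use mom[OF norm_e[OF e]] in \<open>auto simp: less_top[symmetric] top_unique\<close>)
    ultimately show "(\<integral>\<omega>. \<bar>Y \<omega> \<bullet> e\<bar> powr (2 + \<eta>) \<partial>M) \<le> C"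
      using C by (simp add: nn_integral_eq_integral)
  qed
  have int_a: "integrable M a" unfolding a_def[abs_def]
    by (intro Bochner_Integration.integrable_sum Bochner_Integration.integrable_mult_right isotropic_second_moment(1)[OF iso])
  have "(\<integral>\<omega>. a \<omega> \<partial>M) = (\<Sum>e\<in>E. w e * (e \<bullet> e))" unfolding a_def
    by (simp add: Bochner_Integration.integral_sum isotropic_second_moment[OF iso])
  also have "\<dots> = 1" using w1 orthonormal by (simp cong: sum.cong)
  finally have Ea: "(\<integral>\<omega>. a \<omega> \<partial>M) = 1" .
  have int_G: "integrable M G" unfolding G_def[abs_def]
    by (intro Bochner_Integration.integrable_sum Bochner_Integration.integrable_mult_right int_pow)
  have "(\<integral>\<omega>. G \<omega> \<partial>M) = (\<Sum>e\<in>E. (v e + w e) * (\<integral>\<omega>. \<bar>Y \<omega> \<bullet> e\<bar> powr (2 + \<eta>) \<partial>M))"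
    unfolding G_def by (simp add: Bochner_Integration.integral_sum int_pow)
  also have "\<dots> \<le> (\<Sum>e\<in>E. (v e + w e) * C)"
    using v w le_pow by (intro sum_mono mult_left_mono) auto
  also have "\<dots> = 2 * C" by (simp add: sum.distrib v1 w1 flip: sum_distrib_right)
  finally have EG: "(\<integral>\<omega>. G \<omega> \<partial>M) \<le> 2 * C" .
  have int_shift: "integrable M (\<lambda>\<omega>. barrier_shift s \<phi> (matrix_inv B) (Y \<omega>))"
    by (rule integrable_const_bound[of _ "s / \<phi>"])
      (use barrier_shift_bounds[OF s \<phi> pd] in \<open>auto intro!: borel_measurable_barrier_shift\<close>)
  have "(1 - s)\<^sup>2 * (1 - 2 * C * ?r) \<le> (1 - s)\<^sup>2 * (1 - ?r * (\<integral>\<omega>. G \<omega> \<partial>M))"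
    using mult_left_mono[OF EG, of ?r] by (intro mult_left_mono) (auto simp: mult_ac)
  also have "\<dots> = (\<integral>\<omega>. (1 - s)\<^sup>2 * (a \<omega> - ?r * G \<omega>) \<partial>M)"
    using int_a int_G Ea by simp
  also have "\<dots> \<le> (\<integral>\<omega>. barrier_shift s \<phi> (matrix_inv B) (Y \<omega>) \<partial>M)"
    using int_a int_G by (intro integral_mono int_shift pointwise) auto
  finally show ?thesis .
qed

section \<open>The barrier along the sample\<close>

text \<open>The starting value leaves the matrix \<open>mat (n / \<phi>)\<close>, with
  \<open>n\<close> the dimension, whose inverse has trace exactly \<open>\<phi>\<close>. The inverse
  in the step sees only the first \<open>k\<close> vectors; the new vector \<open>x (Suc k)\<close>
  enters separately, which is what independence will exploit.\<close>

primrec spectral_barrier :: "real \<Rightarrow> real \<Rightarrow> (nat \<Rightarrow> real ^ 'n) \<Rightarrow> nat \<Rightarrow> real" where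
  "spectral_barrier s \<phi> x 0 = - real CARD('n) / \<phi>"
| "spectral_barrier s \<phi> x (Suc k) = spectral_barrier s \<phi> x k +
    barrier_shift s \<phi> (matrix_inv ((\<Sum>i=1..k. outer_square (x i)) - mat (spectral_barrier s \<phi> x k))) (x (Suc k))"

text \<open>Adaptedness of the barrier, used to replace the sequence by its restriction to
  \<open>{1..k}\<close> before independence is invoked.\<close>

lemma spectral_barrier_cong:
  assumes "\<And>i. i \<in> {1..k} \<Longrightarrow> x i = y i"
  shows "spectral_barrier s \<phi> x k = spectral_barrier s \<phi> y k"
  using assms
proof (induction k)
  case (Suc k)
  have "(\<Sum>i=1..k. outer_square (x i)) = (\<Sum>i=1..k. outer_square (y i))"
    using Suc.prems by (intro sum.cong) auto
  then show ?case using Suc by simp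
qed simp

lemma barrier_ok_mat:
  assumes "\<phi> > 0"
  shows "barrier_ok \<phi> (mat (real CARD('n) / \<phi>) :: real ^ 'n ^ 'n)"
proof -
  let ?c = "real CARD('n) / \<phi>"
  have c: "?c > 0" using assms by simp
  have "matrix_inv (mat ?c :: real ^ 'n ^ 'n) = mat (1 / ?c)"
  proof (rule matrix_inv_unique)
    show "(mat ?c :: real ^ 'n ^ 'n) ** mat (1 / ?c) = mat 1"
      unfolding matrix_eq using assms by (simp add: matrix_vector_mul_assoc[symmetric] mat_mult_vec)
  qed
  then have "trace (matrix_inv (mat ?c :: real ^ 'n ^ 'n)) = \<phi>"
    using assms by (simp add: trace_def mat_def)
  moreover have "positive_definite (mat ?c :: real ^ 'n ^ 'n)"
    unfolding positive_definite_def mat_mult_vec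
  proof (intro conjI allI impI)
    show "transpose (mat ?c) = (mat ?c :: real ^ 'n ^ 'n)"
      by (simp add: vec_eq_iff transpose_def mat_def)
  qed (use assms in simp)
  ultimately show ?thesis by (simp add: barrier_ok_def)
qed

lemma barrier_ok_spectral_barrier:
  fixes x :: "nat \<Rightarrow> real ^ 'n"
  assumes s: "0 < s" "s < 1" and \<phi>: "\<phi> > 0"
  shows "barrier_ok \<phi> ((\<Sum>i=1..k. outer_square (x i)) - mat (spectral_barrier s \<phi> x k))"
proof (induction k)
  case 0
  have "- mat (- (real CARD('n) / \<phi>)) = (mat (real CARD('n) / \<phi>) :: real ^ 'n ^ 'n)"
    by (simp add: vec_eq_iff mat_def)
  then show ?case using barrier_ok_mat[OF \<phi>, where 'n = 'n] by simp
next
  case (Suc k)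
  let ?A = "\<Sum>i=1..k. outer_square (x i)" and ?l = "spectral_barrier s \<phi> x k"
  let ?d = "barrier_shift s \<phi> (matrix_inv (?A - mat ?l)) (x (Suc k))"
  have eq: "(\<Sum>i=1..Suc k. outer_square (x i)) - mat (spectral_barrier s \<phi> x (Suc k)) =
      ?A - mat ?l - mat ?d + outer_square (x (Suc k))"
    by (simp add: vec_eq_iff mat_def)
  show ?case unfolding eq by (rule barrier_step[OF s Suc.IH])
qed

text \<open>Deterministic bounds, from adding up shifts between 0 and \<open>s / \<phi>\<close>;
  they make the barrier integrable.\<close>

lemma spectral_barrier_bounds:
  fixes x :: "nat \<Rightarrow> real ^ 'n"
  assumes s: "0 < s" "s < 1" and \<phi>: "\<phi> > 0"
  shows "- real CARD('n) / \<phi> \<le> spectral_barrier s \<phi> x k"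
    and "spectral_barrier s \<phi> x k \<le> - real CARD('n) / \<phi> + real k * (s / \<phi>)"
proof (induction k)
  case (Suc k)
  note pd = barrier_ok_spectral_barrier[OF s \<phi>, of x k, unfolded barrier_ok_def, THEN conjunct1]
  note shift = barrier_shift_bounds[OF s \<phi> pd, of "x (Suc k)"]
  {
    case 1
    show ?case using Suc.IH(1) shift(1) by simp
  next
    case 2
    show ?case using Suc.IH(2) shift(2) by (simp add: ring_distribs add_divide_distrib)
  }
qed simp_all

lemma borel_measurable_spectral_barrier:
  assumes "\<And>i. i \<in> {1..k} \<Longrightarrow> (\<lambda>\<omega>. x \<omega> i) \<in> borel_measurable M"
  shows "(\<lambda>\<omega>. spectral_barrier s \<phi> (x \<omega>) k) \<in> borel_measurable M"
  using assms
proof (induction k)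
  case (Suc k)
  then have "(\<lambda>\<omega>. spectral_barrier s \<phi> (x \<omega>) k) \<in> borel_measurable M" by simp
  with Suc.prems show ?case unfolding spectral_barrier.simps
    by (intro borel_measurable_add borel_measurable_barrier_shift borel_measurable_matrix_inv
        borel_measurable_diff borel_measurable_sum borel_measurable_outer_square
        borel_measurable_mat) auto
qed simp

text \<open>Takes the place of conditional expectation: by independence the joint law is a product,
  and Fubini integrates over \<open>V\<close> with \<open>U\<close> frozen. Boundedness of
  \<open>g\<close> supplies integrability.\<close>

lemma (in prob_space) indep_var_integral_ge:
  fixes g :: "'b \<times> 'b \<Rightarrow> real"
  assumes ind: "indep_var S U T V" and g: "g \<in> borel_measurable (S \<Otimes>\<^sub>M T)"
    and bound: "\<And>z. z \<in> space (S \<Otimes>\<^sub>M T) \<Longrightarrow> \<bar>g z\<bar> \<le> K"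
    and ge: "\<And>u. u \<in> space S \<Longrightarrow> c \<le> (\<integral>\<omega>. g (u, V \<omega>) \<partial>M)"
  shows "c \<le> (\<integral>\<omega>. g (U \<omega>, V \<omega>) \<partial>M)"
proof -
  have U[measurable]: "U \<in> measurable M S" and V[measurable]: "V \<in> measurable M T"
    and eq: "distr M S U \<Otimes>\<^sub>M distr M T V = distr M (S \<Otimes>\<^sub>M T) (\<lambda>\<omega>. (U \<omega>, V \<omega>))"
    using ind by (auto simp: indep_var_distribution_eq)
  note g[measurable]
  interpret dU: prob_space "distr M S U" by (rule prob_space_distr) simp
  interpret dV: prob_space "distr M T V" by (rule prob_space_distr) simp
  interpret P: pair_prob_space "distr M S U" "distr M T V" ..
  have int: "integrable (distr M S U \<Otimes>\<^sub>M distr M T V) g"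
    by (rule P.integrable_const_bound[of _ K]) (auto intro!: AE_I2 bound simp: space_pair_measure)
  have "c \<le> (\<integral>u. (\<integral>v. g (u, v) \<partial>distr M T V) \<partial>distr M S U)"
  proof (rule dU.integral_ge_const)
    show "integrable (distr M S U) (\<lambda>u. \<integral>v. g (u, v) \<partial>distr M T V)"
      by (rule P.integrable_fst'[OF int])
    show "AE u in distr M S U. c \<le> (\<integral>v. g (u, v) \<partial>distr M T V)"
    proof (rule AE_I2)
      fix u assume "u \<in> space (distr M S U)"
      then have u: "u \<in> space S" by simp
      then have "(\<lambda>v. g (u, v)) \<in> borel_measurable T" by measurable
      then show "c \<le> (\<integral>v. g (u, v) \<partial>distr M T V)" using ge[OF u] by (simp add: integral_distr)
    qed
  qed
  also have "\<dots> = (\<integral>z. g z \<partial>(distr M S U \<Otimes>\<^sub>M distr M T V))" by (rule P.integral_fst'[OF int])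
  also have "\<dots> = (\<integral>\<omega>. g (U \<omega>, V \<omega>) \<partial>M)" by (simp add: eq integral_distr)
  finally show ?thesis .
qed

text \<open>Induction on \<open>k\<close>: with the past frozen,
  \<open>expectation_barrier_shift\<close> bounds the mean of each increment from below by the same
  constant.\<close>

lemma (in prob_space) expectation_spectral_barrier:
  fixes X :: "nat \<Rightarrow> 'a \<Rightarrow> real ^ 'n"
  assumes ind: "indep_vars (\<lambda>_. borel) X {1..N}"
    and iso: "\<And>i. i \<in> {1..N} \<Longrightarrow> isotropic M (X i)" and \<eta>: "\<eta> > 0" and C: "C \<ge> 0"
    and mom: "\<And>i x. i \<in> {1..N} \<Longrightarrow> norm x = 1 \<Longrightarrow>
      (\<integral>\<^sup>+\<omega>. ennreal (\<bar>X i \<omega> \<bullet> x\<bar> powr (2 + \<eta>)) \<partial>M) \<le> ennreal C"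
    and s: "0 < s" "s < 1" and \<phi>: "\<phi> > 0" and k: "k \<le> N"
  shows "integrable M (\<lambda>\<omega>. spectral_barrier s \<phi> (\<lambda>i. X i \<omega>) k)"
    and "- real CARD('n) / \<phi> + real k * ((1 - s)\<^sup>2 * (1 - 2 * C * (\<phi> / s) powr (\<eta> / 2)))
      \<le> (\<integral>\<omega>. spectral_barrier s \<phi> (\<lambda>i. X i \<omega>) k \<partial>M)"
proof -
  have X: "X i \<in> borel_measurable M" if "i \<in> {1..N}" for i
    using iso[OF that] by (simp add: isotropic_def)
  have integrable: "integrable M (\<lambda>\<omega>. spectral_barrier s \<phi> (\<lambda>i. X i \<omega>) k)" if "k \<le> N" for k
  proof (rule integrable_const_bound)
    let ?b = "real CARD('n) / \<phi> + real k * (s / \<phi>)"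
    have "\<bar>spectral_barrier s \<phi> (\<lambda>i. X i \<omega>) k\<bar> \<le> ?b" for \<omega>
    proof -
      have "0 \<le> real CARD('n) / \<phi>" "0 \<le> real k * (s / \<phi>)" using s \<phi> by auto
      with spectral_barrier_bounds[OF s \<phi>, of "\<lambda>i. X i \<omega>" k] show ?thesis by linarith
    qed
    then show "AE \<omega> in M. norm (spectral_barrier s \<phi> (\<lambda>i. X i \<omega>) k) \<le> ?b" by simp
    show "(\<lambda>\<omega>. spectral_barrier s \<phi> (\<lambda>i. X i \<omega>) k) \<in> borel_measurable M"
      using X that by (intro borel_measurable_spectral_barrier) auto
  qed
  show "integrable M (\<lambda>\<omega>. spectral_barrier s \<phi> (\<lambda>i. X i \<omega>) k)"
    by (rule integrable[OF k])
  let ?c = "(1 - s)\<^sup>2 * (1 - 2 * C * (\<phi> / s) powr (\<eta> / 2))"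
  show "- real CARD('n) / \<phi> + real k * ?c \<le> (\<integral>\<omega>. spectral_barrier s \<phi> (\<lambda>i. X i \<omega>) k \<partial>M)"
    using k
  proof (induction k)
    case 0
    then show ?case by (simp add: prob_space)
  next
    case (Suc k)
    define R where "R x = matrix_inv ((\<Sum>i=1..k. outer_square (x i)) - mat (spectral_barrier s \<phi> x k))"
      for x :: "nat \<Rightarrow> real ^ 'n"
    let ?P = "PiM {1..k} (\<lambda>_. borel :: (real ^ 'n) measure)"
    let ?U = "\<lambda>\<omega>. restrict (\<lambda>i. X i \<omega>) {1..k}"
    let ?Q = "PiM {Suc k} (\<lambda>_. borel :: (real ^ 'n) measure)"
    \<comment> \<open>The new vector is packaged as a family over a singleton, so that past and
      present have the same type, as \<open>indep_var\<close> demands.\<close>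
    let ?V = "\<lambda>\<omega>. restrict (\<lambda>i. X i \<omega>) {Suc k}"
    have indep: "indep_var ?P ?U ?Q ?V"
      by (rule indep_var_restrict[OF ind]) (use Suc.prems in auto)
    have R_restrict: "R (?U \<omega>) = R (\<lambda>i. X i \<omega>)" for \<omega>
    proof -
      have "spectral_barrier s \<phi> (?U \<omega>) k = spectral_barrier s \<phi> (\<lambda>i. X i \<omega>) k"
        by (rule spectral_barrier_cong) simp
      moreover have "(\<Sum>i=1..k. outer_square (?U \<omega> i)) = (\<Sum>i=1..k. outer_square (X i \<omega>))"
        by (intro sum.cong) auto
      ultimately show ?thesis by (simp only: R_def)
    qed
    have ok: "barrier_ok \<phi> ((\<Sum>i=1..k. outer_square (x i)) - mat (spectral_barrier s \<phi> x k))"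
      for x :: "nat \<Rightarrow> real ^ 'n" by (rule barrier_ok_spectral_barrier[OF s \<phi>])
    have "R \<in> borel_measurable ?P" unfolding R_def
      by (intro borel_measurable_matrix_inv borel_measurable_diff borel_measurable_sum
          borel_measurable_outer_square borel_measurable_mat borel_measurable_spectral_barrier
          measurable_component_singleton)
    then have meas: "(\<lambda>z. barrier_shift s \<phi> (R (fst z)) (snd z (Suc k))) \<in> borel_measurable (?P \<Otimes>\<^sub>M ?Q)"
      by (intro borel_measurable_barrier_shift measurable_compose[OF measurable_fst]
          measurable_compose[OF measurable_snd measurable_component_singleton]) auto
    have "?c \<le> (\<integral>\<omega>. (\<lambda>z. barrier_shift s \<phi> (R (fst z)) (snd z (Suc k))) (?U \<omega>, ?V \<omega>) \<partial>M)"
    proof (rule indep_var_integral_ge[OF indep meas])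
      show "\<bar>barrier_shift s \<phi> (R (fst z)) (snd z (Suc k))\<bar> \<le> s / \<phi>" for z
        using barrier_shift_bounds[OF s \<phi> ok[of "fst z", unfolded barrier_ok_def, THEN conjunct1], of "snd z (Suc k)"]
        by (simp only: R_def abs_of_nonneg)
      \<comment> \<open>For a frozen past \<open>u\<close> the matrix is deterministic and satisfies
        \<open>barrier_ok\<close> whatever \<open>u\<close> is.\<close>
      show "?c \<le> (\<integral>\<omega>. (\<lambda>z. barrier_shift s \<phi> (R (fst z)) (snd z (Suc k))) (u, ?V \<omega>) \<partial>M)" for u
        unfolding fst_conv snd_conv R_def restrict_apply'[OF singletonI] using Suc.prems
        by (intro expectation_barrier_shift iso mom \<eta> C s \<phi> ok) auto
    qed
    then have step: "?c \<le> (\<integral>\<omega>. barrier_shift s \<phi> (R (\<lambda>i. X i \<omega>)) (X (Suc k) \<omega>) \<partial>M)"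
      by (simp only: fst_conv snd_conv R_restrict restrict_apply'[OF singletonI])
    have diff: "barrier_shift s \<phi> (R (\<lambda>i. X i \<omega>)) (X (Suc k) \<omega>) =
        spectral_barrier s \<phi> (\<lambda>i. X i \<omega>) (Suc k) - spectral_barrier s \<phi> (\<lambda>i. X i \<omega>) k" for \<omega>
      by (simp add: R_def)
    have "(\<integral>\<omega>. barrier_shift s \<phi> (R (\<lambda>i. X i \<omega>)) (X (Suc k) \<omega>) \<partial>M) =
        (\<integral>\<omega>. spectral_barrier s \<phi> (\<lambda>i. X i \<omega>) (Suc k) \<partial>M) -
        (\<integral>\<omega>. spectral_barrier s \<phi> (\<lambda>i. X i \<omega>) k \<partial>M)"
      unfolding diff using Suc.prems by (intro Bochner_Integration.integral_diff integrable) auto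
    with step Suc show ?case by (simp add: ring_distribs)
  qed
qed

section \<open>The smallest eigenvalue of the sample covariance matrix\<close>

lemma transpose_sample_covariance: "transpose (sample_covariance N X \<omega>) = sample_covariance N X \<omega>"
  by (simp add: sample_covariance_def vec_eq_iff transpose_def outer_square_def mult.commute)

lemma matrix_vector_mult_sum: "(\<Sum>i\<in>I. A i) *v v = (\<Sum>i\<in>I. A i *v (v :: real ^ 'n))"
  by (induction I rule: infinite_finite_induct) (simp_all add: matrix_vector_mult_add_rdistrib)

lemma sample_covariance_form:
  "v \<bullet> (sample_covariance N X \<omega> *v v) = (1 / real N) * (\<Sum>i=1..N. (X i \<omega> \<bullet> v)\<^sup>2)"
  by (simp add: sample_covariance_def scaleR_matrix_vector_assoc[symmetric] matrix_vector_mult_sum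
      outer_square_mult_vec inner_sum_right power2_eq_square inner_commute)

text \<open>Positive definiteness above the barrier is a Rayleigh bound for the sum of the rank-one
  matrices; dividing by \<open>N\<close> transfers it to the mean.\<close>

lemma spectral_barrier_le_lambda_min:
  assumes s: "0 < s" "s < 1" and \<phi>: "\<phi> > 0" and N: "N \<ge> 1"
  shows "spectral_barrier s \<phi> (\<lambda>i. X i \<omega>) N / real N \<le> lambda_min (sample_covariance N X \<omega>)"
  unfolding lambda_min_rayleigh[OF transpose_sample_covariance]
proof
  fix v
  let ?l = "spectral_barrier s \<phi> (\<lambda>i. X i \<omega>) N" and ?A = "\<Sum>i=1..N. outer_square (X i \<omega>)"
  have "positive_definite (?A - mat ?l)"
    using barrier_ok_spectral_barrier[OF s \<phi>, of "\<lambda>i. X i \<omega>" N] by (simp add: barrier_ok_def)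
  then have "0 \<le> v \<bullet> ((?A - mat ?l) *v v)"
    by (cases "v = 0") (auto simp: positive_definite_def intro: less_imp_le)
  then have "?l * (v \<bullet> v) \<le> v \<bullet> (?A *v v)"
    by (simp add: matrix_vector_mult_diff_rdistrib mat_mult_vec inner_diff_right)
  then have "?l * (v \<bullet> v) / real N \<le> v \<bullet> (?A *v v) / real N" by (rule divide_right_mono) simp
  then show "?l / real N * (v \<bullet> v) \<le> v \<bullet> (sample_covariance N X \<omega> *v v)"
    by (simp add: sample_covariance_def scaleR_matrix_vector_assoc[symmetric])
qed

lemma lambda_min_sample_covariance_nonneg: "0 \<le> lambda_min (sample_covariance N X \<omega>)"
  unfolding lambda_min_rayleigh[OF transpose_sample_covariance]
  by (simp add: sample_covariance_form sum_nonneg)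

text \<open>The smallest eigenvalue lies between 0 and the quadratic form at any fixed unit vector,
  here an arbitrary coordinate vector, and that form is integrable by isotropy.\<close>

lemma integrable_lambda_min_sample_covariance:
  fixes X :: "nat \<Rightarrow> 'a \<Rightarrow> real ^ 'n"
  assumes iso: "\<And>i. i \<in> {1..N} \<Longrightarrow> isotropic M (X i)"
  shows "integrable M (\<lambda>\<omega>. lambda_min (sample_covariance N X \<omega>))"
proof (rule Bochner_Integration.integrable_bound)
  let ?v = "axis undefined 1 :: real ^ 'n"
  show "integrable M (\<lambda>\<omega>. (1 / real N) * (\<Sum>i=1..N. (X i \<omega> \<bullet> ?v)\<^sup>2))"
    by (intro Bochner_Integration.integrable_mult_right Bochner_Integration.integrable_sum isotropic_second_moment iso)
  have "(\<lambda>\<omega>. sample_covariance N X \<omega>) \<in> borel_measurable M"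
    unfolding sample_covariance_def using iso
    by (intro borel_measurable_scaleR borel_measurable_sum borel_measurable_outer_square)
      (auto simp: isotropic_def)
  then show "(\<lambda>\<omega>. lambda_min (sample_covariance N X \<omega>)) \<in> borel_measurable M"
    by (rule borel_measurable_lambda_min[OF _ transpose_sample_covariance])
  have "lambda_min (sample_covariance N X \<omega>) \<le> (1 / real N) * (\<Sum>i=1..N. (X i \<omega> \<bullet> ?v)\<^sup>2)" for \<omega>
    using lambda_min_rayleigh[OF transpose_sample_covariance, THEN iffD1, OF order_refl, rule_format, of N X \<omega> ?v]
    by (simp only: sample_covariance_form inner_axis_axis) simp
  then show "AE \<omega> in M. norm (lambda_min (sample_covariance N X \<omega>))
      \<le> norm ((1 / real N) * (\<Sum>i=1..N. (X i \<omega> \<bullet> ?v)\<^sup>2))"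
    unfolding real_norm_def abs_of_nonneg[OF lambda_min_sample_covariance_nonneg]
    by (intro AE_I2 order_trans[OF _ abs_ge_self])
qed

theorem theorem1p5:
  fixes M :: "'a measure"
    and X :: "nat \<Rightarrow> 'a \<Rightarrow> real ^ 'n"
    and N :: nat
    and C \<eta> \<epsilon> :: real
  assumes "prob_space M"
    and "N \<ge> 1"
    and "prob_space.indep_vars M (\<lambda>_. borel) X {1..N}"
    and "\<And>i. i \<in> {1..N} \<Longrightarrow> isotropic M (X i)"
    and "C > 0" and "\<eta> > 0"
    and "\<And>i. i \<in> {1..N} \<Longrightarrow>
           (SUP x\<in>{x. norm x \<le> 1}. \<integral>\<^sup>+\<omega>. ennreal (\<bar>X i \<omega> \<bullet> x\<bar> powr (2 + \<eta>)) \<partial>M) \<le> ennreal C"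
    and "\<epsilon> > 0"
    and "real N \<ge> 40 * (10 * C) powr (2 / \<eta>) * \<epsilon> powr (- 2 - 2 / \<eta>) * real CARD('n)"
  shows "integrable M (\<lambda>\<omega>. lambda_min (sample_covariance N X \<omega>)) \<and>
         (\<integral>\<omega>. lambda_min (sample_covariance N X \<omega>) \<partial>M) \<ge> 1 - \<epsilon>"
proof
  interpret prob_space M by fact
  show integrable: "integrable M (\<lambda>\<omega>. lambda_min (sample_covariance N X \<omega>))"
    using assms(4) by (rule integrable_lambda_min_sample_covariance)
  show "(\<integral>\<omega>. lambda_min (sample_covariance N X \<omega>) \<partial>M) \<ge> 1 - \<epsilon>"
  proof (cases "\<epsilon> < 1")
    case False
    \<comment> \<open>For \<open>\<epsilon> \<ge> 1\<close> nonnegativity suffices; the other case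
      may then rely on \<open>s < 1\<close>.\<close>
    have "(\<integral>\<omega>. lambda_min (sample_covariance N X \<omega>) \<partial>M) \<ge> 0"
      by (simp add: integral_nonneg_AE lambda_min_sample_covariance_nonneg)
    then show ?thesis using False by simp
  next
    case True
    define P where "P = (10 * C) powr (2 / \<eta>)"
    define Q where "Q = \<epsilon> powr (2 / \<eta>)"
    define s where "s = \<epsilon> / 10"
    \<comment> \<open>Chosen so that the exponent \<open>\<eta> / 2\<close> undoes
      \<open>2 / \<eta>\<close> and the truncation loss becomes exactly
      \<open>\<epsilon> / 5\<close>.\<close>
    define \<phi> where "\<phi> = s * (Q / P)"
    have P: "P > 0" and Q: "Q > 0" using assms by (simp_all add: P_def Q_def)
    have s: "0 < s" "s < 1" and \<phi>: "\<phi> > 0" using True assms P Q by (simp_all add: s_def \<phi>_def)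
    have "\<phi> / s = (\<epsilon> / (10 * C)) powr (2 / \<eta>)"
      using s assms by (simp add: \<phi>_def P_def Q_def powr_divide)
    then have "(\<phi> / s) powr (\<eta> / 2) = \<epsilon> / (10 * C)"
      using assms by (simp add: powr_powr)
    then have tail: "2 * C * (\<phi> / s) powr (\<eta> / 2) = \<epsilon> / 5" using assms by simp
    \<comment> \<open>The square costs at most \<open>2 * s = \<epsilon> / 5\<close> and the
      truncation another \<open>\<epsilon> / 5\<close>.\<close>
    have drift: "1 - 2 * \<epsilon> / 5 \<le> (1 - s)\<^sup>2 * (1 - 2 * C * (\<phi> / s) powr (\<eta> / 2))"
    proof -
      have "1 - \<epsilon> / 5 \<le> (1 - s)\<^sup>2" by (simp add: s_def power2_eq_square algebra_simps)
      from mult_right_mono[OF this, of "1 - \<epsilon> / 5"] True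
      have "(1 - \<epsilon> / 5) * (1 - \<epsilon> / 5) \<le> (1 - s)\<^sup>2 * (1 - \<epsilon> / 5)" by simp
      moreover have "1 - 2 * \<epsilon> / 5 \<le> (1 - \<epsilon> / 5) * (1 - \<epsilon> / 5)" by (simp add: algebra_simps)
      ultimately show ?thesis by (simp add: tail)
    qed
    \<comment> \<open>The constant 40 is 10 from \<open>s = \<epsilon> / 10\<close> times 4 from the
      share \<open>\<epsilon> / 4\<close> granted to the initial debt.\<close>
    have initial: "real CARD('n) / \<phi> \<le> real N * (\<epsilon> / 4)"
    proof -
      have "- 2 - 2 / \<eta> = - (2 + 2 / \<eta>)" by simp
      then have "\<epsilon> powr (- 2 - 2 / \<eta>) = 1 / (\<epsilon> powr 2 * Q)"
        by (simp only: Q_def powr_minus powr_add inverse_eq_divide)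
      also have "\<epsilon> powr 2 = \<epsilon>\<^sup>2" using assms by simp
      finally have "\<epsilon> powr (- 2 - 2 / \<eta>) = 1 / (\<epsilon>\<^sup>2 * Q)" .
      then have "40 * P * (1 / (\<epsilon>\<^sup>2 * Q)) * real CARD('n) \<le> real N" using assms(9) by (simp add: P_def)
      then have "40 * P * (1 / (\<epsilon>\<^sup>2 * Q)) * real CARD('n) * (\<epsilon> / 4) \<le> real N * (\<epsilon> / 4)"
        using assms by (intro mult_right_mono) auto
      then show ?thesis using assms P Q by (simp add: \<phi>_def s_def power2_eq_square field_simps)
    qed
    have mom: "(\<integral>\<^sup>+\<omega>. ennreal (\<bar>X i \<omega> \<bullet> x\<bar> powr (2 + \<eta>)) \<partial>M) \<le> ennreal C"
      if "i \<in> {1..N}" "norm x = 1" for i x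
      by (rule order_trans[OF SUP_upper assms(7)[OF that(1)]]) (use that in auto)
    have "C \<ge> 0" using assms by simp
    note barrier = expectation_spectral_barrier[OF assms(3,4,6) \<open>C \<ge> 0\<close> mom s \<phi> order_refl]
    \<comment> \<open>The total loss per sample is at most
      \<open>\<epsilon> / 4 + 2 * \<epsilon> / 5\<close>, which is below
      \<open>\<epsilon>\<close>.\<close>
    have "real N * (1 - \<epsilon>) \<le> - real CARD('n) / \<phi> + real N * (1 - 2 * \<epsilon> / 5)"
    proof -
      have "0 \<le> real N * \<epsilon>" using assms by simp
      then show ?thesis using initial by (simp add: algebra_simps)
    qed
    also have "\<dots> \<le> - real CARD('n) / \<phi> +
        real N * ((1 - s)\<^sup>2 * (1 - 2 * C * (\<phi> / s) powr (\<eta> / 2)))"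
      using drift by (intro add_left_mono mult_left_mono) auto
    also note barrier(2)
    finally have "1 - \<epsilon> \<le> (\<integral>\<omega>. spectral_barrier s \<phi> (\<lambda>i. X i \<omega>) N \<partial>M) / real N"
      using assms(2) by (simp add: field_simps)
    also have "\<dots> = (\<integral>\<omega>. spectral_barrier s \<phi> (\<lambda>i. X i \<omega>) N / real N \<partial>M)" by simp
    also have "\<dots> \<le> (\<integral>\<omega>. lambda_min (sample_covariance N X \<omega>) \<partial>M)"
      by (intro integral_mono integrable integrable_divide_zero barrier(1)
          spectral_barrier_le_lambda_min s \<phi> assms(2)) simp_all
    finally show ?thesis .
  qed
qed

end
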